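(* Let $\alpha>1$, let $0<C_1\le C_2$ be constants, let $K\ge 1$ be a fixed integer, and let $p=\frac{\alpha\ln n}{n}$. Let $G=(V,E)$ be a random graph from $\mathbb{G}(n,p)$ and let $N=(G,c)$ be an electrical network on $G$ whose conductances satisfy $C_1\le c_{ij}\le C_2$ for all $(i,j)\in E$. Let $\Gamma=\{x_1,\dots,x_K\}\subset V$ be a set of $K$ distinct boundary vertices with prescribed boundary potentials $V_{x_k}=p_{x_k}$, where $0\le p_{x_k}\le 1$ for $k=1,\dots,K$. Then with high probability (i.e. with probability $1-o(1)$ as $n\to\infty$) the potential distribution $(V_i)_{i\in V}$ satisfies \[ V_i=\frac{\sum_{k=1}^K p_{x_k}c_{x_k}}{\sum_{k=1}^K c_{x_k}}+O\big((\ln n)^{-1}\big)\qquad\text{for every } i\in V\setminus\Gamma . \]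
   Context: $\mathbb{G}(n,p)$ is the Erdős–Rényi random graph on $n$ vertices in which each of the $\binom n2$ possible edges is present independently with probability $p$. An electrical network $N=(G,c)$ on a connected simple graph $G=(V,E)$ assigns to each edge $(i,j)\in E$ a conductance $c_{ij}=c_{ji}>0$ (the reciprocal of its resistance $r_{ij}$); write $c_i=\sum_{j:(i,j)\in E}c_{ij}$ for the total conductance at vertex $i$. Given a boundary set $\Gamma\subset V$ with prescribed values $V_{x}$ for $x\in\Gamma$, the potential distribution is the function $V:V\to\mathbb{R}$ taking the prescribed values on $\Gamma$ and satisfying Kirchhoff's and Ohm's laws at every non-boundary vertex, i.e. $\sum_{j:(i,j)\in E}c_{ij}(V_i-V_j)=0$ (equivalently $V_i=\sum_{j:(i,j)\in E}\frac{c_{ij}}{c_i}V_j$) for all $i\in V\setminus\Gamma$. The statement is asserted on the event (of probability $1-o(1)$) that $G$ is connected. The implied constant in $O((\ln n)^{-1})$ depends only on $\alpha, C_1,C_2,K$. *)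

theory Defs
  imports "HOL-Probability.Probability"
begin

text \<open>A graph on vertex set {0..<n} is encoded by its edge indicator
  f :: nat \<times> nat \<Rightarrow> bool on ordered pairs (i,j) with i < j < n.\<close>

definition gnp :: "nat \<Rightarrow> real \<Rightarrow> (nat \<times> nat \<Rightarrow> bool) pmf" where
  "gnp n p = Pi_pmf {(i, j). i < j \<and> j < n} False (\<lambda>_. bernoulli_pmf p)"

definition adj :: "(nat \<times> nat \<Rightarrow> bool) \<Rightarrow> nat \<Rightarrow> nat \<Rightarrow> bool" where
  "adj f i j \<longleftrightarrow> i \<noteq> j \<and> f (min i j, max i j)"

definition graph_connected :: "nat \<Rightarrow> (nat \<times> nat \<Rightarrow> bool) \<Rightarrow> bool" where
  "graph_connected n f \<longleftrightarrow> (\<forall>i<n. \<forall>j<n. (adj f)\<^sup>*\<^sup>* i j)"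

definition neighbours :: "nat \<Rightarrow> (nat \<times> nat \<Rightarrow> bool) \<Rightarrow> nat \<Rightarrow> nat set" where
  "neighbours n f i = {j. j < n \<and> adj f i j}"

definition total_cond :: "nat \<Rightarrow> (nat \<times> nat \<Rightarrow> bool) \<Rightarrow> (nat \<Rightarrow> nat \<Rightarrow> real) \<Rightarrow> nat \<Rightarrow> real" where
  "total_cond n f c i = (\<Sum>j\<in>neighbours n f i. c i j)"

definition admissible_cond :: "nat \<Rightarrow> (nat \<times> nat \<Rightarrow> bool) \<Rightarrow> real \<Rightarrow> real \<Rightarrow> (nat \<Rightarrow> nat \<Rightarrow> real) \<Rightarrow> bool" where
  "admissible_cond n f C1 C2 c \<longleftrightarrow>
     (\<forall>i<n. \<forall>j<n. adj f i j \<longrightarrow> c i j = c j i \<and> C1 \<le> c i j \<and> c i j \<le> C2)"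

text \<open>V is the potential distribution for boundary set \<Gamma> = x ` {..<K}
  with boundary values V (x k) = pv k (Kirchhoff + Ohm at non-boundary vertices).\<close>
definition is_potential :: "nat \<Rightarrow> (nat \<times> nat \<Rightarrow> bool) \<Rightarrow> (nat \<Rightarrow> nat \<Rightarrow> real) \<Rightarrow>
    nat \<Rightarrow> (nat \<Rightarrow> nat) \<Rightarrow> (nat \<Rightarrow> real) \<Rightarrow> (nat \<Rightarrow> real) \<Rightarrow> bool" where
  "is_potential n f c K x pv V \<longleftrightarrow>
     (\<forall>k<K. V (x k) = pv k) \<and>
     (\<forall>i<n. i \<notin> x ` {..<K} \<longrightarrow> (\<Sum>j\<in>neighbours n f i. c i j * (V i - V j)) = 0)"

definition good_event :: "nat \<Rightarrow> real \<Rightarrow> real \<Rightarrow> nat \<Rightarrow> real \<Rightarrow> (nat \<times> nat \<Rightarrow> bool) \<Rightarrow> bool" where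
  "good_event n C1 C2 K M f \<longleftrightarrow> graph_connected n f \<and>
     (\<forall>c x pv V. admissible_cond n f C1 C2 c \<longrightarrow> inj_on x {..<K} \<longrightarrow> x ` {..<K} \<subseteq> {..<n} \<longrightarrow>
        (\<forall>k<K. 0 \<le> pv k \<and> pv k \<le> 1) \<longrightarrow> is_potential n f c K x pv V \<longrightarrow>
        (\<forall>i<n. i \<notin> x ` {..<K} \<longrightarrow>
          \<bar>V i - (\<Sum>k<K. pv k * total_cond n f c (x k)) / (\<Sum>k<K. total_cond n f c (x k))\<bar>
            \<le> M / ln (real n)))"

end

theory Submission
  imports Defs "HOL-Real_Asymp.Real_Asymp"
begin

text \<open>
  With high probability the random graph has edge expansion and maximum degree of order \<open>ln n\<close>,
  and any two vertices have at most two common neighbours; these three properties imply the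
  estimate for all conductances, boundary sets and boundary values at once. By the maximum
  principle the potential \<open>V\<close> takes values in \<open>[0, 1]\<close>, so its Dirichlet energy, which is the
  current leaving the boundary weighted by \<open>V\<close>, is \<open>O(ln n)\<close>. Cheeger's argument gives a spectral
  gap of order \<open>ln n\<close>, whence the sum of \<open>(V i - m)\<^sup>2\<close> is \<open>O(1)\<close> for a median \<open>m\<close> of \<open>V\<close>.
  Replacing \<open>V i\<close> by its mean over two steps of the network random walk costs \<open>O(1 / ln n)\<close> for
  hitting the boundary, and the two-step distribution has \<open>\<ell>\<^sup>2\<close> norm \<open>O(1 / ln n)\<close> because
  codegrees are bounded, so \<open>V i = m + O(1 / ln n)\<close> by Cauchy-Schwarz. Finally, the total current
  through the boundary vanishes, which forces \<open>m\<close> to agree with the conductance-weighted boundary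
  mean up to \<open>O(1 / ln n)\<close>.
\<close>

section \<open>Expansion and the Poincare inequality\<close>

locale finite_graph =
  fixes U :: "'a set" and N :: "'a \<Rightarrow> 'a set"
  assumes finite_vertices: "finite U"
    and nbr_subset: "i \<in> U \<Longrightarrow> N i \<subseteq> U"
    and nbr_sym: "i \<in> U \<Longrightarrow> j \<in> N i \<Longrightarrow> i \<in> N j"
begin

lemma finite_nbr: "i \<in> U \<Longrightarrow> finite (N i)"
  using finite_vertices nbr_subset finite_subset by blast

lemma nbr_in: "i \<in> U \<Longrightarrow> j \<in> N i \<Longrightarrow> j \<in> U"
  using nbr_subset by blast

text \<open>Adjacency is symmetric, so reversing ordered adjacent pairs is a bijection. This is the
  summation by parts behind the Cheeger and energy arguments.\<close>

lemma sum_nbr_swap: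
  fixes g :: "'a \<Rightarrow> 'a \<Rightarrow> real"
  shows "(\<Sum>i\<in>U. \<Sum>j\<in>N i. g i j) = (\<Sum>i\<in>U. \<Sum>j\<in>N i. g j i)"
proof -
  have "(\<Sum>i\<in>U. \<Sum>j\<in>N i. g i j) = (\<Sum>(i, j)\<in>Sigma U N. g i j)"
    by (intro sum.Sigma finite_vertices ballI finite_nbr)
  also have "\<dots> = (\<Sum>(i, j)\<in>Sigma U N. g j i)"
    by (rule sum.reindex_bij_witness[where i = "\<lambda>(i, j). (j, i)" and j = "\<lambda>(i, j). (j, i)"])
      (auto intro: nbr_in nbr_sym)
  also have "\<dots> = (\<Sum>i\<in>U. \<Sum>j\<in>N i. g j i)"
    by (intro sum.Sigma[symmetric] finite_vertices ballI finite_nbr)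
  finally show ?thesis .
qed

definition cut :: "'a set \<Rightarrow> real" where
  "cut S = (\<Sum>i\<in>S. real (card (N i - S)))"

text \<open>The factor 2 arises because a sum over ordered pairs meets each boundary edge from both
  ends; \<open>g\<close> picks out one of the two orientations.\<close>

lemma cut_eq_sum:
  assumes "T \<subseteq> U"
  shows "(\<Sum>i\<in>U. \<Sum>j\<in>N i. of_bool ((i \<in> T) \<noteq> (j \<in> T))) = 2 * cut T"
proof -
  define g where "g i j = (of_bool (i \<in> T \<and> j \<notin> T) :: real)" for i j
  have g: "(\<Sum>i\<in>U. \<Sum>j\<in>N i. g i j) = cut T"
  proof -
    have "(\<Sum>i\<in>U. \<Sum>j\<in>N i. g i j) = (\<Sum>i\<in>T. \<Sum>j\<in>N i. g i j)"
      using assms finite_vertices by (intro sum.mono_neutral_right) (auto simp: g_def)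
    also have "\<dots> = cut T"
      unfolding cut_def
    proof (rule sum.cong)
      fix i assume i: "i \<in> T"
      then have "finite (N i)" using assms finite_nbr by blast
      then have "(\<Sum>j\<in>N i. g i j) = real (card (N i \<inter> {j. j \<notin> T}))"
        using i by (simp add: g_def)
      also have "N i \<inter> {j. j \<notin> T} = N i - T" by auto
      finally show "(\<Sum>j\<in>N i. g i j) = real (card (N i - T))" .
    qed simp
    finally show ?thesis .
  qed
  have "(\<Sum>i\<in>U. \<Sum>j\<in>N i. of_bool ((i \<in> T) \<noteq> (j \<in> T)))
      = (\<Sum>i\<in>U. \<Sum>j\<in>N i. g i j + g j i)"
    by (intro sum.cong) (auto simp: g_def)
  also have "\<dots> = (\<Sum>i\<in>U. \<Sum>j\<in>N i. g i j) + (\<Sum>i\<in>U. \<Sum>j\<in>N i. g j i)"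
    by (simp add: sum.distrib)
  finally show ?thesis
    using g sum_nbr_swap[of g] by simp
qed

end

section \<open>Edge expansion and Cheeger's inequality\<close>

locale expander = finite_graph +
  fixes h :: real
  assumes h_pos: "0 < h"
    and expansion: "S \<subseteq> U \<Longrightarrow> 2 * card S \<le> card U \<Longrightarrow> h * card S \<le> cut S"
begin

lemma cut_neq_0:
  assumes "S \<subseteq> U" "S \<noteq> {}" "2 * card S \<le> card U"
  shows "cut S \<noteq> 0"
proof -
  have "card S > 0"
    using assms finite_vertices by (meson card_gt_0_iff finite_subset)
  then have "0 < h * card S" using h_pos by simp
  then show ?thesis using expansion[of S] assms by simp
qed

text \<open>A closed set and its complement both have cut 0, and one of them contains at most half
  of the vertices, so expansion forces that one to be empty. This is connectedness in the form that
  the maximum principle uses.\<close>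

lemma closed_set_is_everything:
  assumes "A \<subseteq> U" "A \<noteq> {}" and cl: "\<And>i. i \<in> A \<Longrightarrow> N i \<subseteq> A"
  shows "A = U"
proof (rule ccontr)
  assume "A \<noteq> U"
  have A0: "cut A = 0"
    unfolding cut_def using cl
    by (intro sum.neutral ballI) (metis Diff_eq_empty_iff card.empty of_nat_0)
  have "N i \<subseteq> U - A" if "i \<in> U - A" for i
    using that cl nbr_sym[of i] nbr_in[of i] by blast
  then have B0: "cut (U - A) = 0"
    unfolding cut_def
    by (intro sum.neutral ballI) (metis Diff_eq_empty_iff card.empty of_nat_0)
  have "card A + card (U - A) = card U"
    using assms(1) finite_vertices by (metis card_Diff_subset card_mono finite_subset le_add_diff_inverse)
  then consider "2 * card A \<le> card U" | "2 * card (U - A) \<le> card U" by linarith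
  then show False
    using cut_neq_0[of A] cut_neq_0[of "U - A"] A0 B0 assms \<open>A \<noteq> U\<close> by cases auto
qed

text \<open>Expansion of a singleton. All lower bounds on total conductances rest on this.\<close>

lemma min_degree:
  assumes "i \<in> U" "2 \<le> card U"
  shows "h \<le> card (N i)"
proof -
  have "h \<le> card (N i - {i})"
    using expansion[of "{i}"] assms by (simp add: cut_def)
  also have "\<dots> \<le> card (N i)"
    using finite_nbr[OF assms(1)] by (simp add: card_mono)
  finally show ?thesis .
qed

text \<open>A discrete co-area formula: peel off the lowest positive level of \<open>a\<close>.\<close>

lemma isoperimetric_sum:
  fixes a :: "'a \<Rightarrow> real"
  assumes "\<And>i. i \<in> U \<Longrightarrow> 0 \<le> a i" and "2 * card {i \<in> U. a i \<noteq> 0} \<le> card U"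
  shows "2 * h * (\<Sum>i\<in>U. a i) \<le> (\<Sum>i\<in>U. \<Sum>j\<in>N i. \<bar>a i - a j\<bar>)"
  using assms
proof (induction "card {i \<in> U. a i \<noteq> 0}" arbitrary: a rule: less_induct)
  case less
  define T where "T = {i \<in> U. a i \<noteq> 0}"
  have TU: "T \<subseteq> U" and finT: "finite T" using finite_vertices by (auto simp: T_def)
  show ?case
  proof (cases "T = {}")
    case True
    then have "(\<Sum>i\<in>U. a i) = 0" by (intro sum.neutral) (auto simp: T_def)
    then show ?thesis by (simp add: sum_nonneg)
  next
    case False
    \<comment> \<open>Subtracting the least positive value on the support removes at least one
      vertex from it, so the induction on the size of the support applies to
      \<open>b\<close>.\<close>
    define t where "t = Min (a ` T)"
    define b where "b i = (if i \<in> T then a i - t else 0)" for i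
    have t_le: "t \<le> a i" if "i \<in> T" for i
      using that finT by (simp add: t_def)
    obtain i0 where i0: "i0 \<in> T" "a i0 = t"
      using Min_in[of "a ` T"] finT False unfolding t_def by fastforce
    have t_pos: "0 < t"
      using i0 less.prems(1)[of i0] by (auto simp: T_def)
    have b_supp: "{i \<in> U. b i \<noteq> 0} \<subset> T"
      using i0 TU by (auto simp: b_def)
    have card_less: "card {i \<in> U. b i \<noteq> 0} < card T"
      using psubset_card_mono[OF finT b_supp] .
    have IH: "2 * h * (\<Sum>i\<in>U. b i) \<le> (\<Sum>i\<in>U. \<Sum>j\<in>N i. \<bar>b i - b j\<bar>)"
    proof (rule less.hyps)
      show "card {i \<in> U. b i \<noteq> 0} < card {i \<in> U. a i \<noteq> 0}"
        using card_less by (simp add: T_def)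
      show "0 \<le> b i" if "i \<in> U" for i using t_le by (simp add: b_def)
      show "2 * card {i \<in> U. b i \<noteq> 0} \<le> card U"
        using card_less less.prems(2) by (simp add: T_def)
    qed
    have ab: "a i = b i + t * of_bool (i \<in> T)" if "i \<in> U" for i
      using that by (auto simp: b_def T_def)
    have sum_a: "(\<Sum>i\<in>U. a i) = (\<Sum>i\<in>U. b i) + t * card T"
    proof -
      have "(\<Sum>i\<in>U. a i) = (\<Sum>i\<in>U. b i) + t * (\<Sum>i\<in>U. of_bool (i \<in> T))"
        by (simp add: ab sum.distrib sum_distrib_left)
      also have "(\<Sum>i\<in>U. of_bool (i \<in> T)) = real (card (U \<inter> T))"
        using finite_vertices by simp
      also have "U \<inter> T = T" using TU by auto
      finally show ?thesis .
    qed
    \<comment> \<open>Only edges cut by \<open>T\<close> lose \<open>t\<close>: inside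
      \<open>T\<close> both ends drop equally, and on a cut edge one end is 0 and the other at least
      \<open>t\<close>, so no sign changes.\<close>
    have edge: "\<bar>a i - a j\<bar> = \<bar>b i - b j\<bar> + t * of_bool ((i \<in> T) \<noteq> (j \<in> T))"
      if "i \<in> U" "j \<in> N i" for i j
      using ab[OF that(1)] ab[OF nbr_in[OF that]] t_pos t_le[of i] t_le[of j]
      by (auto simp: b_def)
    have "(\<Sum>i\<in>U. \<Sum>j\<in>N i. \<bar>a i - a j\<bar>)
        = (\<Sum>i\<in>U. \<Sum>j\<in>N i. \<bar>b i - b j\<bar>) + t * (\<Sum>i\<in>U. \<Sum>j\<in>N i. of_bool ((i \<in> T) \<noteq> (j \<in> T)))"
      by (simp add: edge sum.distrib sum_distrib_left cong: sum.cong)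
    also have "\<dots> = (\<Sum>i\<in>U. \<Sum>j\<in>N i. \<bar>b i - b j\<bar>) + t * (2 * cut T)"
      using cut_eq_sum[OF TU] by simp
    also have "\<dots> \<ge> 2 * h * (\<Sum>i\<in>U. b i) + t * (2 * (h * card T))"
      using IH expansion[OF TU] less.prems(2) t_pos
      by (intro add_mono mult_left_mono) (auto simp: T_def)
    finally show ?thesis by (simp add: sum_a algebra_simps)
  qed
qed

text \<open>Cheeger's argument: apply the isoperimetric sum to the squares of \<open>g\<close>,
  split each difference of squares by a weighted AM-GM inequality, and absorb the part without
  differences into the left-hand side.\<close>

lemma poincare_half_support:
  fixes g :: "'a \<Rightarrow> real" and \<Delta> :: real
  assumes g: "\<And>i. i \<in> U \<Longrightarrow> 0 \<le> g i" and supp: "2 * card {i \<in> U. g i \<noteq> 0} \<le> card U"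
    and deg: "\<And>i. i \<in> U \<Longrightarrow> card (N i) \<le> \<Delta>" and "0 < \<Delta>"
  shows "(\<Sum>i\<in>U. (g i)\<^sup>2) \<le> \<Delta> / h\<^sup>2 * (\<Sum>i\<in>U. \<Sum>j\<in>N i. (g i - g j)\<^sup>2)"
proof -
  define X where "X = (\<Sum>i\<in>U. (g i)\<^sup>2)"
  define E where "E = (\<Sum>i\<in>U. \<Sum>j\<in>N i. (g i - g j)\<^sup>2)"
  \<comment> \<open>With this weight the two error terms \<open>e * (\<Delta> * X)\<close> add up to
    \<open>h * X\<close>, exactly half of the left-hand side \<open>2 * h * X\<close>.\<close>
  define e where "e = h / (2 * \<Delta>)"
  have e: "0 < e" using h_pos \<open>0 < \<Delta>\<close> by (simp add: e_def)
  have half: "(\<Sum>i\<in>U. \<Sum>j\<in>N i. (g i)\<^sup>2) \<le> \<Delta> * X"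
    unfolding X_def sum_distrib_left
    using deg by (intro sum_mono) (auto intro!: mult_right_mono)
  have "2 * h * X \<le> (\<Sum>i\<in>U. \<Sum>j\<in>N i. \<bar>(g i)\<^sup>2 - (g j)\<^sup>2\<bar>)"
    unfolding X_def using supp by (intro isoperimetric_sum) auto
  also have "\<dots> \<le> (\<Sum>i\<in>U. \<Sum>j\<in>N i. 1 / (2 * e) * (g i - g j)\<^sup>2 + e * (g i)\<^sup>2 + e * (g j)\<^sup>2)"
  proof (intro sum_mono)
    fix i j assume "i \<in> U" "j \<in> N i"
    define x y where "x = \<bar>g i - g j\<bar>" and "y = g i + g j"
    have "0 \<le> y" using g \<open>i \<in> U\<close> \<open>j \<in> N i\<close> nbr_in by (simp add: y_def)
    have "\<bar>(g i)\<^sup>2 - (g j)\<^sup>2\<bar> = x * y"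
      using \<open>0 \<le> y\<close> by (simp add: x_def y_def power2_eq_square square_diff_square_factored abs_mult)
    also have "\<dots> \<le> 1 / (2 * e) * x\<^sup>2 + e / 2 * y\<^sup>2"
    proof -
      have "0 \<le> (x - e * y)\<^sup>2 / (2 * e)" using e by simp
      also have "\<dots> = 1 / (2 * e) * x\<^sup>2 + e / 2 * y\<^sup>2 - x * y"
        using e by (simp add: field_simps power2_eq_square)
      finally show ?thesis by simp
    qed
    also have "e / 2 * y\<^sup>2 \<le> e * (g i)\<^sup>2 + e * (g j)\<^sup>2"
    proof -
      have "y\<^sup>2 \<le> 2 * ((g i)\<^sup>2 + (g j)\<^sup>2)"
        using zero_le_power2[of "g i - g j"] by (simp add: y_def power2_eq_square algebra_simps)
      then have "e / 2 * y\<^sup>2 \<le> e / 2 * (2 * ((g i)\<^sup>2 + (g j)\<^sup>2))"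
        using e by (intro mult_left_mono) auto
      then show ?thesis by (simp add: algebra_simps)
    qed
    finally show "\<bar>(g i)\<^sup>2 - (g j)\<^sup>2\<bar> \<le> 1 / (2 * e) * (g i - g j)\<^sup>2 + e * (g i)\<^sup>2 + e * (g j)\<^sup>2"
      by (simp add: x_def)
  qed
  also have "\<dots> = 1 / (2 * e) * E + e * (\<Sum>i\<in>U. \<Sum>j\<in>N i. (g i)\<^sup>2) + e * (\<Sum>i\<in>U. \<Sum>j\<in>N i. (g j)\<^sup>2)"
    by (simp only: E_def sum.distrib sum_distrib_left)
  also have "(\<Sum>i\<in>U. \<Sum>j\<in>N i. (g j)\<^sup>2) = (\<Sum>i\<in>U. \<Sum>j\<in>N i. (g i)\<^sup>2)"
    by (rule sum_nbr_swap)
  also have "1 / (2 * e) * E + e * (\<Sum>i\<in>U. \<Sum>j\<in>N i. (g i)\<^sup>2) + e * (\<Sum>i\<in>U. \<Sum>j\<in>N i. (g i)\<^sup>2)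
      \<le> 1 / (2 * e) * E + e * (\<Delta> * X) + e * (\<Delta> * X)"
    using half e by (intro add_mono mult_left_mono) auto
  also have "\<dots> = \<Delta> / h * E + h * X"
    using h_pos \<open>0 < \<Delta>\<close> by (simp add: e_def field_simps)
  finally have "X * h \<le> \<Delta> / h * E" by (simp add: mult.commute)
  then have "X \<le> \<Delta> / h * E / h"
    using h_pos by (simp only: pos_le_divide_eq)
  then show ?thesis by (simp add: X_def E_def power2_eq_square)
qed

text \<open>The positive and negative parts of \<open>v\<close> are each supported on at most half
  of the vertices, so the previous bound applies to both. Along an edge their increments never have
  the same sign, hence their energies add up to at most that of \<open>v\<close>.\<close>

lemma poincare_median:
  fixes v :: "'a \<Rightarrow> real" and \<Delta> :: real
  assumes pos: "2 * card {i \<in> U. 0 < v i} \<le> card U" and neg: "2 * card {i \<in> U. v i < 0} \<le> card U"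
    and deg: "\<And>i. i \<in> U \<Longrightarrow> card (N i) \<le> \<Delta>" and "0 < \<Delta>"
  shows "(\<Sum>i\<in>U. (v i)\<^sup>2) \<le> \<Delta> / h\<^sup>2 * (\<Sum>i\<in>U. \<Sum>j\<in>N i. (v i - v j)\<^sup>2)"
proof -
  define p q where "p i = max (v i) 0" and "q i = max (- v i) 0" for i
  have "{i \<in> U. p i \<noteq> 0} = {i \<in> U. 0 < v i}" "{i \<in> U. q i \<noteq> 0} = {i \<in> U. v i < 0}"
    by (auto simp: p_def q_def max_def)
  then have p: "(\<Sum>i\<in>U. (p i)\<^sup>2) \<le> \<Delta> / h\<^sup>2 * (\<Sum>i\<in>U. \<Sum>j\<in>N i. (p i - p j)\<^sup>2)"
    and q: "(\<Sum>i\<in>U. (q i)\<^sup>2) \<le> \<Delta> / h\<^sup>2 * (\<Sum>i\<in>U. \<Sum>j\<in>N i. (q i - q j)\<^sup>2)"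
    using pos neg deg \<open>0 < \<Delta>\<close> poincare_half_support[of p \<Delta>] poincare_half_support[of q \<Delta>]
    by (simp_all add: p_def q_def)
  have pq: "(p i - p j)\<^sup>2 + (q i - q j)\<^sup>2 \<le> (v i - v j)\<^sup>2" for i j
  proof -
    have "v i - v j = (p i - p j) - (q i - q j)" by (auto simp: p_def q_def max_def)
    moreover have "(p i - p j) * (q i - q j) \<le> 0"
      by (auto simp: p_def q_def max_def mult_le_0_iff)
    moreover have "(x - y)\<^sup>2 = x\<^sup>2 + y\<^sup>2 - 2 * (x * y)" for x y :: real
      by (simp add: power2_eq_square algebra_simps)
    ultimately show ?thesis by simp
  qed
  have "(v i)\<^sup>2 = (p i)\<^sup>2 + (q i)\<^sup>2" for i by (auto simp: p_def q_def max_def)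
  then have "(\<Sum>i\<in>U. (v i)\<^sup>2) = (\<Sum>i\<in>U. (p i)\<^sup>2) + (\<Sum>i\<in>U. (q i)\<^sup>2)"
    by (simp add: sum.distrib)
  also have "\<dots> \<le> \<Delta> / h\<^sup>2 * (\<Sum>i\<in>U. \<Sum>j\<in>N i. (p i - p j)\<^sup>2 + (q i - q j)\<^sup>2)"
    using p q by (simp add: sum.distrib algebra_simps)
  also have "\<dots> \<le> \<Delta> / h\<^sup>2 * (\<Sum>i\<in>U. \<Sum>j\<in>N i. (v i - v j)\<^sup>2)"
    using pq \<open>0 < \<Delta>\<close> by (intro mult_left_mono sum_mono) auto
  finally show ?thesis .
qed

end

text \<open>Take the least value with at most half of the points strictly above it. If some points
  lie below, the largest value among them fails the test by minimality, so more than half of the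
  points lie above that value and fewer than half below the median. Choosing an attained value later
  puts \<open>m\<close> into [0, 1].\<close>

lemma median_exists:
  fixes V :: "'a \<Rightarrow> real"
  assumes "finite U" "U \<noteq> {}"
  obtains m where "m \<in> V ` U" "2 * card {i \<in> U. m < V i} \<le> card U"
    "2 * card {i \<in> U. V i < m} \<le> card U"
proof -
  define T where "T = {t \<in> V ` U. 2 * card {i \<in> U. t < V i} \<le> card U}"
  have finT: "finite T" using assms by (simp add: T_def)
  have "V i \<le> Max (V ` U)" if "i \<in> U" for i using assms that by simp
  then have "{i \<in> U. Max (V ` U) < V i} = {}" by (auto simp: not_less)
  then have "2 * card {i \<in> U. Max (V ` U) < V i} \<le> card U" by (simp only: card.empty)
  moreover have "Max (V ` U) \<in> V ` U" using assms by (intro Max_in) auto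
  ultimately have "Max (V ` U) \<in> T" unfolding T_def by blast
  then have mT: "Min T \<in> T" using finT Min_in by blast
  have "2 * card {i \<in> U. V i < Min T} \<le> card U"
  proof (cases "{i \<in> U. V i < Min T} = {}")
    case False
    define B where "B = {i \<in> U. V i < Min T}"
    have B: "finite B" "B \<noteq> {}" using assms False by (auto simp: B_def)
    define s where "s = Max (V ` B)"
    have s: "s \<in> V ` B" unfolding s_def using B by (intro Max_in) auto
    then have "s < Min T" by (auto simp: B_def)
    then have "s \<notin> T" using finT by (meson Min_le not_less)
    then have "card U < 2 * card {i \<in> U. s < V i}" using s by (auto simp: T_def B_def)
    moreover have "{i \<in> U. s < V i} = U - B"
      using B \<open>s < Min T\<close> by (auto simp: B_def s_def not_less intro: Max_ge)
    moreover have "card (U - B) = card U - card B" "card B \<le> card U"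
      using assms by (auto simp: B_def intro!: card_Diff_subset card_mono)
    ultimately show ?thesis by (simp add: B_def)
  qed (simp only: card.empty)
  then show ?thesis using mT that[of "Min T"] by (auto simp: T_def)
qed

section \<open>Harmonic functions on a network\<close>

locale network = expander U N h for U :: "'a set" and N h +
  fixes c :: "'a \<Rightarrow> 'a \<Rightarrow> real" and C1 C2 :: real
  assumes c_sym: "i \<in> U \<Longrightarrow> j \<in> N i \<Longrightarrow> c i j = c j i"
    and c_ge: "i \<in> U \<Longrightarrow> j \<in> N i \<Longrightarrow> C1 \<le> c i j"
    and c_le: "i \<in> U \<Longrightarrow> j \<in> N i \<Longrightarrow> c i j \<le> C2"
    and C1_pos: "0 < C1"
    and card_U: "2 \<le> card U"
begin

section \<open>Currents, Dirichlet energy and the maximum principle\<close>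

definition cond :: "'a \<Rightarrow> real" where
  "cond i = (\<Sum>j\<in>N i. c i j)"

text \<open>The weighted graph Laplacian of \<open>V\<close>; harmonicity at a vertex is expressed
  by its vanishing there.\<close>

definition current :: "('a \<Rightarrow> real) \<Rightarrow> 'a \<Rightarrow> real" where
  "current V i = (\<Sum>j\<in>N i. c i j * (V i - V j))"

lemma c_pos: "i \<in> U \<Longrightarrow> j \<in> N i \<Longrightarrow> 0 < c i j"
  using c_ge C1_pos by (meson less_le_trans)

lemma C2_pos: "0 < C2"
proof -
  obtain i where i: "i \<in> U" using card_U by fastforce
  then have "0 < real (card (N i))" using min_degree[OF i card_U] h_pos by linarith
  then obtain j where "j \<in> N i" by fastforce
  then show ?thesis using i c_pos[of i j] c_le[of i j] by linarith
qed

lemma cond_ge: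
  assumes "i \<in> U"
  shows "C1 * h \<le> cond i"
proof -
  have "C1 * h \<le> C1 * card (N i)"
    using min_degree[OF assms card_U] C1_pos by simp
  also have "\<dots> = (\<Sum>j\<in>N i. C1)" by simp
  also have "\<dots> \<le> cond i"
    unfolding cond_def using c_ge assms by (intro sum_mono)
  finally show ?thesis .
qed

lemma cond_pos: "i \<in> U \<Longrightarrow> 0 < cond i"
  using cond_ge[of i] C1_pos h_pos by (smt (verit) mult_pos_pos)

lemma current_eq: "current V i = cond i * V i - (\<Sum>j\<in>N i. c i j * V j)"
  by (simp add: current_def cond_def sum_distrib_right sum_subtractf right_diff_distrib)

text \<open>Seen from its two ends an edge carries opposite currents, so the sum equals its own
  negative.\<close>

lemma sum_current: "(\<Sum>i\<in>U. current V i) = 0"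
proof -
  have "(\<Sum>i\<in>U. current V i) = (\<Sum>i\<in>U. \<Sum>j\<in>N i. c j i * (V j - V i))"
    unfolding current_def by (rule sum_nbr_swap)
  also have "\<dots> = (\<Sum>i\<in>U. \<Sum>j\<in>N i. - (c i j * (V i - V j)))"
    by (intro sum.cong refl) (metis c_sym minus_diff_eq mult_minus_right)
  also have "\<dots> = - (\<Sum>i\<in>U. current V i)"
    by (simp add: current_def sum_negf)
  finally show ?thesis by simp
qed

text \<open>Green's identity, with a factor 2 because every edge is counted in both orientations.
  For a harmonic function only boundary vertices contribute on the right.\<close>

lemma energy_eq:
  "(\<Sum>i\<in>U. \<Sum>j\<in>N i. c i j * (V i - V j)\<^sup>2) = 2 * (\<Sum>i\<in>U. V i * current V i)"
proof -
  have "(\<Sum>i\<in>U. \<Sum>j\<in>N i. c i j * (V i - V j)\<^sup>2)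
      = (\<Sum>i\<in>U. \<Sum>j\<in>N i. V i * (c i j * (V i - V j)) + V j * (c j i * (V j - V i)))"
  proof (intro sum.cong refl)
    fix i j assume "i \<in> U" "j \<in> N i"
    then have "c j i = c i j" by (metis c_sym)
    then show "c i j * (V i - V j)\<^sup>2 = V i * (c i j * (V i - V j)) + V j * (c j i * (V j - V i))"
      by (simp add: power2_eq_square algebra_simps)
  qed
  also have "\<dots> = (\<Sum>i\<in>U. \<Sum>j\<in>N i. V i * (c i j * (V i - V j)))
      + (\<Sum>i\<in>U. \<Sum>j\<in>N i. V j * (c j i * (V j - V i)))"
    by (simp only: sum.distrib)
  also have "(\<Sum>i\<in>U. \<Sum>j\<in>N i. V j * (c j i * (V j - V i)))
      = (\<Sum>i\<in>U. \<Sum>j\<in>N i. V i * (c i j * (V i - V j)))"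
    by (rule sum_nbr_swap[symmetric])
  finally show ?thesis by (simp add: current_def sum_distrib_left)
qed

text \<open>At a maximiser with zero current, a vanishing sum of nonnegative terms forces every
  neighbour to be a maximiser too. If all maximisers avoided \<open>\<Gamma>\<close>, they would
  form a closed set and hence fill \<open>U\<close>.\<close>

lemma maximum_principle:
  assumes "\<Gamma> \<subseteq> U" "\<Gamma> \<noteq> {}" and bd: "\<And>x. x \<in> \<Gamma> \<Longrightarrow> V x \<le> B"
    and harm: "\<And>i. i \<in> U - \<Gamma> \<Longrightarrow> current V i = 0" and "i \<in> U"
  shows "V i \<le> B"
proof -
  define M where "M = Max (V ` U)"
  have M: "V j \<le> M" if "j \<in> U" for j
    using that finite_vertices by (simp add: M_def)
  define A where "A = {j \<in> U. V j = M}"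
  have "M \<in> V ` U" unfolding M_def using \<open>i \<in> U\<close> finite_vertices by (intro Max_in) auto
  then have "A \<noteq> {}" by (auto simp: A_def)
  have "A \<inter> \<Gamma> \<noteq> {}"
  proof
    assume empty: "A \<inter> \<Gamma> = {}"
    have "N k \<subseteq> A" if k: "k \<in> A" for k
    proof
      fix j assume j: "j \<in> N k"
      have kU: "k \<in> U" and Vk: "V k = M" using k by (auto simp: A_def)
      have nonneg: "0 \<le> c k l * (V k - V l)" if "l \<in> N k" for l
        using c_pos[OF kU that] M[OF nbr_in[OF kU that]] Vk by simp
      have "current V k = 0" using harm[of k] kU k empty by blast
      then have "c k j * (V k - V j) = 0"
        unfolding current_def using nonneg j finite_nbr[OF kU]
        by (subst (asm) sum_nonneg_eq_0_iff) auto
      then show "j \<in> A"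
        using c_pos[OF kU j] Vk nbr_in[OF kU j] by (simp add: A_def)
    qed
    then have "A = U"
      using \<open>A \<noteq> {}\<close> by (intro closed_set_is_everything) (auto simp: A_def)
    then show False using empty assms by blast
  qed
  then have "M \<le> B" using bd by (auto simp: A_def)
  then show ?thesis using M[OF \<open>i \<in> U\<close>] by simp
qed

section \<open>The network random walk and its two-step averages\<close>

definition step :: "'a \<Rightarrow> 'a \<Rightarrow> real" where
  "step i j = (if j \<in> N i then c i j / cond i else 0)"

lemma step_nonneg: "i \<in> U \<Longrightarrow> 0 \<le> step i j"
  using c_pos[of i j] cond_pos[of i] by (auto simp: step_def less_imp_le)

lemma sum_step:
  assumes "i \<in> U"
  shows "(\<Sum>j\<in>U. step i j * g j) = (\<Sum>j\<in>N i. c i j * g j) / cond i"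
proof -
  have "(\<Sum>j\<in>U. step i j * g j) = (\<Sum>j\<in>N i. step i j * g j)"
    using nbr_subset[OF assms] finite_vertices
    by (intro sum.mono_neutral_right) (auto simp: step_def)
  then show ?thesis by (simp add: step_def sum_divide_distrib)
qed

lemma sum_step_1: "i \<in> U \<Longrightarrow> (\<Sum>j\<in>U. step i j) = 1"
  using sum_step[of i "\<lambda>_. 1"] cond_pos[of i] by (simp add: cond_def)

text \<open>One edge has conductance at most \<open>C2\<close>, while the total at a vertex is at
  least \<open>C1 * h\<close>. With \<open>h\<close> of order ln n this is the source of the rate 1
  / ln n.\<close>

lemma step_le:
  assumes "i \<in> U"
  shows "step i j \<le> C2 / (C1 * h)"
proof (cases "j \<in> N i")
  case True
  then show ?thesis
    unfolding step_def using c_le[OF assms True] cond_ge[OF assms] C1_pos C2_pos h_pos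
    by (auto intro!: frac_le)
next
  case False
  then show ?thesis using C1_pos C2_pos h_pos by (simp add: step_def)
qed

lemma step_mean_value:
  assumes "i \<in> U" "current V i = 0"
  shows "(\<Sum>j\<in>U. step i j * (V j - m)) = V i - m"
proof -
  have "(\<Sum>j\<in>U. step i j * (V j - m)) = (\<Sum>j\<in>U. step i j * V j) - m * (\<Sum>j\<in>U. step i j)"
    by (simp add: sum_distrib_left sum_subtractf algebra_simps)
  also have "\<dots> = V i - m"
  proof -
    have "(\<Sum>j\<in>N i. c i j * V j) = V i * cond i"
      using assms(2) by (simp add: current_eq mult.commute)
    then show ?thesis using assms(1) cond_pos[of i] by (simp add: sum_step sum_step_1)
  qed
  finally show ?thesis .
qed

text \<open>Bounded codegrees make the two-step transition probabilities quadratically small off the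
  diagonal, so a bound on the \<open>\<ell>\<^sup>2\<close> distance of a harmonic function from a constant already gives
  a pointwise one after two steps of the walk.\<close>

lemma harmonic_pointwise:
  assumes \<Gamma>: "\<Gamma> \<subseteq> U" and harm: "\<And>i. i \<in> U - \<Gamma> \<Longrightarrow> current V i = 0"
    and bounded: "\<And>i. i \<in> \<Gamma> \<Longrightarrow> \<bar>V i - m\<bar> \<le> 1"
    and l2: "(\<Sum>i\<in>U. (V i - m)\<^sup>2) \<le> A"
    and codeg: "\<And>i k. i \<in> U \<Longrightarrow> k \<in> U \<Longrightarrow> i \<noteq> k \<Longrightarrow> card (N i \<inter> N k) \<le> 2"
    and i: "i \<in> U - \<Gamma>"
  shows "\<bar>V i - m\<bar> \<le> (card \<Gamma> + sqrt (3 * A)) * (C2 / (C1 * h))"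
proof -
  define \<rho> where "\<rho> = C2 / (C1 * h)"
  have \<rho>: "0 < \<rho>" using C1_pos C2_pos h_pos by (simp add: \<rho>_def)
  define v where "v j = V j - m" for j
  have iU: "i \<in> U" using i by simp
  \<comment> \<open>Paths whose middle vertex lies in \<open>\<Gamma>\<close> are left out, because
    the mean value property can be used a second time only at harmonic vertices.\<close>
  define Q where "Q k = (\<Sum>j\<in>U - \<Gamma>. step i j * step j k)" for k
  have Q_nonneg: "0 \<le> Q k" for k
    unfolding Q_def using iU by (intro sum_nonneg mult_nonneg_nonneg step_nonneg) auto
  have Q_le: "Q k \<le> (\<Sum>j\<in>U. step i j * step j k)" for k
    unfolding Q_def using iU finite_vertices
    by (intro sum_mono2 mult_nonneg_nonneg step_nonneg) auto
  \<comment> \<open>Returning to \<open>i\<close> is possible through any neighbour, so codegrees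
    give nothing here and only one factor \<open>\<rho>\<close> is gained.\<close>
  have Q_diag: "Q i \<le> \<rho>"
  proof -
    have "Q i \<le> (\<Sum>j\<in>U. step i j * \<rho>)"
      using iU by (intro order.trans[OF Q_le] sum_mono mult_left_mono)
        (auto simp: \<rho>_def step_nonneg step_le)
    also have "\<dots> = \<rho>" using iU by (simp add: sum_distrib_right[symmetric] sum_step_1)
    finally show ?thesis .
  qed
  have Q_off: "Q k \<le> 2 * \<rho>\<^sup>2" if k: "k \<in> U" "k \<noteq> i" for k
  proof -
    have "Q k \<le> (\<Sum>j\<in>U. step i j * step j k)" by (rule Q_le)
    also have "\<dots> = (\<Sum>j\<in>N i \<inter> N k. step i j * step j k)"
    proof (rule sum.mono_neutral_right)
      show "N i \<inter> N k \<subseteq> U" using nbr_subset iU by blast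
      show "\<forall>j\<in>U - N i \<inter> N k. step i j * step j k = 0"
        using nbr_sym by (auto simp: step_def)
    qed (rule finite_vertices)
    also have "\<dots> \<le> (\<Sum>j\<in>N i \<inter> N k. \<rho> * \<rho>)"
      using iU nbr_in[OF iU] \<rho> unfolding \<rho>_def
      by (intro sum_mono mult_mono step_le step_nonneg) auto
    also have "\<dots> = card (N i \<inter> N k) * \<rho>\<^sup>2" by (simp add: power2_eq_square)
    also have "\<dots> \<le> 2 * \<rho>\<^sup>2"
      using codeg[of i k] iU k by (intro mult_right_mono) auto
    finally show ?thesis .
  qed
  have Q_sum: "(\<Sum>k\<in>U. Q k) \<le> 1"
  proof -
    have "(\<Sum>k\<in>U. Q k) \<le> (\<Sum>k\<in>U. \<Sum>j\<in>U. step i j * step j k)"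
      by (intro sum_mono Q_le)
    also have "\<dots> = (\<Sum>j\<in>U. step i j * (\<Sum>k\<in>U. step j k))"
      by (subst sum.swap) (simp add: sum_distrib_left)
    also have "\<dots> = 1" using iU by (simp add: sum_step_1)
    finally show ?thesis .
  qed
  \<comment> \<open>The diagonal entry contributes at most \<open>\<rho>\<^sup>2\<close>. Elsewhere
    one factor \<open>Q k\<close> is at most \<open>2 * \<rho>\<^sup>2\<close>, and the other
    factors sum to at most 1.\<close>
  have Q_l2: "(\<Sum>k\<in>U. (Q k)\<^sup>2) \<le> 3 * \<rho>\<^sup>2"
  proof -
    have "(\<Sum>k\<in>U. (Q k)\<^sup>2) = (Q i)\<^sup>2 + (\<Sum>k\<in>U - {i}. (Q k)\<^sup>2)"
      using iU finite_vertices by (simp add: sum.remove)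
    also have "\<dots> \<le> \<rho>\<^sup>2 + (\<Sum>k\<in>U - {i}. 2 * \<rho>\<^sup>2 * Q k)"
      using Q_diag Q_nonneg Q_off
      by (intro add_mono power_mono sum_mono) (auto simp: power2_eq_square intro!: mult_right_mono)
    also have "(\<Sum>k\<in>U - {i}. 2 * \<rho>\<^sup>2 * Q k) \<le> (\<Sum>k\<in>U. 2 * \<rho>\<^sup>2 * Q k)"
      using finite_vertices Q_nonneg by (intro sum_mono2) auto
    also have "\<dots> \<le> 2 * \<rho>\<^sup>2 * 1"
      unfolding sum_distrib_left[symmetric] using Q_sum by (intro mult_left_mono) auto
    finally show ?thesis by simp
  qed
  have two_step: "(\<Sum>j\<in>U - \<Gamma>. step i j * v j) = (\<Sum>k\<in>U. Q k * v k)"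
  proof -
    have "(\<Sum>j\<in>U - \<Gamma>. step i j * v j) = (\<Sum>j\<in>U - \<Gamma>. step i j * (\<Sum>k\<in>U. step j k * v k))"
      unfolding v_def using harm by (intro sum.cong) (auto simp: step_mean_value)
    also have "\<dots> = (\<Sum>j\<in>U - \<Gamma>. \<Sum>k\<in>U. step i j * step j k * v k)"
      by (simp add: sum_distrib_left mult.assoc)
    also have "\<dots> = (\<Sum>k\<in>U. Q k * v k)"
      by (subst sum.swap) (simp add: Q_def sum_distrib_right)
    finally show ?thesis .
  qed
  have "(\<Sum>k\<in>U. Q k * v k)\<^sup>2 \<le> (\<Sum>k\<in>U. (Q k)\<^sup>2) * (\<Sum>k\<in>U. (v k)\<^sup>2)"
    by (rule Cauchy_Schwarz_ineq_sum)
  also have "\<dots> \<le> (3 * \<rho>\<^sup>2) * A"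
    using Q_l2 l2 by (intro mult_mono) (auto simp: v_def sum_nonneg)
  finally have "\<bar>\<Sum>k\<in>U. Q k * v k\<bar> \<le> sqrt (3 * A * \<rho>\<^sup>2)"
    by (intro real_le_rsqrt) (simp add: algebra_simps)
  then have inner: "\<bar>\<Sum>k\<in>U. Q k * v k\<bar> \<le> sqrt (3 * A) * \<rho>"
    using \<rho> by (simp add: real_sqrt_mult)
  \<comment> \<open>The cost of a first step into the boundary, where \<open>v\<close> is known only
    to be bounded by 1.\<close>
  have outer: "\<bar>\<Sum>j\<in>\<Gamma>. step i j * v j\<bar> \<le> card \<Gamma> * \<rho>"
  proof -
    have "\<bar>\<Sum>j\<in>\<Gamma>. step i j * v j\<bar> \<le> (\<Sum>j\<in>\<Gamma>. \<bar>step i j * v j\<bar>)" by (rule sum_abs)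
    also have "\<dots> \<le> (\<Sum>j\<in>\<Gamma>. \<rho> * 1)"
      unfolding abs_mult using \<rho> iU bounded
      by (intro sum_mono mult_mono) (auto simp: \<rho>_def v_def step_nonneg step_le)
    finally show ?thesis by simp
  qed
  have "v i = (\<Sum>j\<in>U. step i j * v j)"
    unfolding v_def using step_mean_value[OF iU harm[OF i]] by simp
  also have "\<dots> = (\<Sum>j\<in>U - \<Gamma>. step i j * v j) + (\<Sum>j\<in>\<Gamma>. step i j * v j)"
    using \<Gamma> finite_vertices by (rule sum.subset_diff)
  finally have "\<bar>v i\<bar> \<le> sqrt (3 * A) * \<rho> + card \<Gamma> * \<rho>"
    using inner outer unfolding two_step by linarith
  then show ?thesis by (simp add: v_def \<rho>_def algebra_simps)
qed

text \<open>The constant is identified by conservation of the total current through the boundary.\<close>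

lemma boundary_mean_near_constant:
  assumes \<Gamma>: "\<Gamma> \<subseteq> U" "\<Gamma> \<noteq> {}" and harm: "\<And>i. i \<in> U - \<Gamma> \<Longrightarrow> current V i = 0"
    and bd: "\<And>i. i \<in> \<Gamma> \<Longrightarrow> \<bar>V i - m\<bar> \<le> 1"
    and int: "\<And>i. i \<in> U - \<Gamma> \<Longrightarrow> \<bar>V i - m\<bar> \<le> B" and "0 \<le> B"
  shows "\<bar>(\<Sum>x\<in>\<Gamma>. V x * cond x) / (\<Sum>x\<in>\<Gamma>. cond x) - m\<bar> \<le> B + card \<Gamma> * (C2 / (C1 * h))"
proof -
  define W where "W = (\<Sum>x\<in>\<Gamma>. cond x)"
  have fin\<Gamma>: "finite \<Gamma>" using \<Gamma> finite_vertices finite_subset by blast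
  have card\<Gamma>: "0 < card \<Gamma>" using fin\<Gamma> \<Gamma> by (simp add: card_gt_0_iff)
  have "card \<Gamma> * (C1 * h) = (\<Sum>x\<in>\<Gamma>. C1 * h)" by simp
  also have "\<dots> \<le> W" unfolding W_def using \<Gamma> cond_ge by (intro sum_mono) auto
  finally have W_ge: "card \<Gamma> * (C1 * h) \<le> W" .
  have C1h: "0 < C1 * h" using C1_pos h_pos by simp
  have W: "0 < W" using W_ge C1h card\<Gamma> by (smt (verit) mult_pos_pos of_nat_0_less_iff)
  \<comment> \<open>Interior neighbours deviate from \<open>m\<close> by at most \<open>B\<close>.
    Boundary neighbours may deviate by 1, but there are at most \<open>card \<Gamma>\<close> of
    them.\<close>
  have local: "\<bar>\<Sum>j\<in>N x. c x j * (V j - m)\<bar> \<le> B * cond x + C2 * card \<Gamma>" if x: "x \<in> \<Gamma>" for x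
  proof -
    have xU: "x \<in> U" using x \<Gamma> by auto
    have "\<bar>\<Sum>j\<in>N x. c x j * (V j - m)\<bar> \<le> (\<Sum>j\<in>N x. \<bar>c x j * (V j - m)\<bar>)"
      by (rule sum_abs)
    also have "\<dots> \<le> (\<Sum>j\<in>N x. B * c x j + C2 * of_bool (j \<in> \<Gamma>))"
    proof (rule sum_mono)
      fix j assume j: "j \<in> N x"
      have cj: "0 < c x j" "c x j \<le> C2" using c_pos c_le xU j by auto
      show "\<bar>c x j * (V j - m)\<bar> \<le> B * c x j + C2 * of_bool (j \<in> \<Gamma>)"
      proof (cases "j \<in> \<Gamma>")
        case True
        have "c x j * \<bar>V j - m\<bar> \<le> C2 * 1"
          using cj bd[OF True] C2_pos by (intro mult_mono) auto
        moreover have "0 \<le> B * c x j" using cj \<open>0 \<le> B\<close> by simp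
        ultimately show ?thesis using True cj by (simp add: abs_mult)
      next
        case False
        then have "c x j * \<bar>V j - m\<bar> \<le> c x j * B"
          using cj int[of j] nbr_in[OF xU j] by (intro mult_left_mono) auto
        then show ?thesis using False cj by (simp add: abs_mult mult.commute)
      qed
    qed
    also have "\<dots> = B * cond x + C2 * (\<Sum>j\<in>N x. of_bool (j \<in> \<Gamma>))"
      by (simp only: cond_def sum.distrib sum_distrib_left)
    also have "(\<Sum>j\<in>N x. of_bool (j \<in> \<Gamma>)) = real (card (N x \<inter> \<Gamma>))"
      using finite_nbr[OF xU] by simp
    also have "B * cond x + C2 * card (N x \<inter> \<Gamma>) \<le> B * cond x + C2 * card \<Gamma>"
      using C2_pos fin\<Gamma> by (simp add: card_mono)
    finally show ?thesis .
  qed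
  have "0 = (\<Sum>i\<in>U. current V i)" by (simp add: sum_current)
  also have "\<dots> = (\<Sum>x\<in>\<Gamma>. current V x)"
    using \<Gamma> finite_vertices harm by (intro sum.mono_neutral_right) auto
  also have "\<dots> = (\<Sum>x\<in>\<Gamma>. (V x * cond x - m * cond x) - (\<Sum>j\<in>N x. c x j * (V j - m)))"
  proof (intro sum.cong refl)
    fix x
    have "(\<Sum>j\<in>N x. c x j * (V j - m)) = (\<Sum>j\<in>N x. c x j * V j) - m * cond x"
      by (simp add: cond_def right_diff_distrib sum_subtractf sum_distrib_left mult.commute)
    then show "current V x = (V x * cond x - m * cond x) - (\<Sum>j\<in>N x. c x j * (V j - m))"
      by (simp add: current_eq mult.commute)
  qed
  also have "\<dots> = (\<Sum>x\<in>\<Gamma>. V x * cond x) - m * W - (\<Sum>x\<in>\<Gamma>. \<Sum>j\<in>N x. c x j * (V j - m))"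
    by (simp add: W_def sum_subtractf sum_distrib_left)
  finally have "\<bar>(\<Sum>x\<in>\<Gamma>. V x * cond x) - m * W\<bar> = \<bar>\<Sum>x\<in>\<Gamma>. \<Sum>j\<in>N x. c x j * (V j - m)\<bar>"
    by simp
  also have "\<dots> \<le> (\<Sum>x\<in>\<Gamma>. B * cond x + C2 * card \<Gamma>)"
    by (intro order.trans[OF sum_abs] sum_mono local)
  \<comment> \<open>The absolute error is rewritten around the lower bound for \<open>W\<close>, so
    that the whole right-hand side becomes a multiple of \<open>W\<close> and can be divided by
    it.\<close>
  also have "\<dots> = B * W + card \<Gamma> * (C2 / (C1 * h)) * (card \<Gamma> * (C1 * h))"
    using C1_pos h_pos by (simp add: W_def sum.distrib sum_distrib_left field_simps)
  also have "\<dots> \<le> B * W + card \<Gamma> * (C2 / (C1 * h)) * W"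
    using W_ge C2_pos C1h by (intro add_left_mono mult_left_mono) auto
  finally have "\<bar>(\<Sum>x\<in>\<Gamma>. V x * cond x) - m * W\<bar> \<le> (B + card \<Gamma> * (C2 / (C1 * h))) * W"
    by (simp add: algebra_simps)
  then have "\<bar>(\<Sum>x\<in>\<Gamma>. V x * cond x) - m * W\<bar> / W \<le> B + card \<Gamma> * (C2 / (C1 * h))"
    using W by (simp only: pos_divide_le_eq)
  moreover have "\<bar>(\<Sum>x\<in>\<Gamma>. V x * cond x) - m * W\<bar> / W = \<bar>(\<Sum>x\<in>\<Gamma>. V x * cond x) / W - m\<bar>"
  proof -
    have "(\<Sum>x\<in>\<Gamma>. V x * cond x) / W - m = ((\<Sum>x\<in>\<Gamma>. V x * cond x) - m * W) / W"
      using W by (simp add: diff_divide_distrib)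
    then show ?thesis by (simp only: abs_divide abs_of_pos[OF W])
  qed
  ultimately show ?thesis by (simp add: W_def)
qed

text \<open>The energy equals the potential-weighted boundary current, at most
  \<open>C2 * \<Delta>\<close> per boundary vertex up to the factor 2, and the Poincare inequality
  about the median turns this into an l2 bound. When \<open>\<Delta>\<close> and \<open>h\<close>
  have the same order, the bound is a constant.\<close>

lemma harmonic_l2:
  fixes \<Delta> :: real
  assumes \<Gamma>: "\<Gamma> \<subseteq> U" and harm: "\<And>i. i \<in> U - \<Gamma> \<Longrightarrow> current V i = 0"
    and V: "\<And>i. i \<in> U \<Longrightarrow> 0 \<le> V i \<and> V i \<le> 1"
    and deg: "\<And>i. i \<in> U \<Longrightarrow> card (N i) \<le> \<Delta>" and "0 < \<Delta>"
    and pos: "2 * card {i \<in> U. m < V i} \<le> card U" and neg: "2 * card {i \<in> U. V i < m} \<le> card U"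
  shows "(\<Sum>i\<in>U. (V i - m)\<^sup>2) \<le> 2 * card \<Gamma> * C2 / C1 * (\<Delta> / h)\<^sup>2"
proof -
  define E where "E = (\<Sum>i\<in>U. \<Sum>j\<in>N i. (V i - V j)\<^sup>2)"
  have current_le: "V i * current V i \<le> C2 * \<Delta>" if i: "i \<in> U" for i
  proof -
    have "current V i \<le> (\<Sum>j\<in>N i. C2 * 1)"
      unfolding current_def
    proof (rule sum_mono)
      fix j assume j: "j \<in> N i"
      have "c i j * (V i - V j) \<le> c i j * 1"
        using c_pos[OF i j] V[OF i] V[OF nbr_in[OF i j]] by (intro mult_left_mono) auto
      then show "c i j * (V i - V j) \<le> C2 * 1" using c_le[OF i j] by simp
    qed
    also have "\<dots> = C2 * card (N i)" by simp
    also have "\<dots> \<le> C2 * \<Delta>" using deg[OF i] C2_pos by simp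
    finally have "V i * current V i \<le> V i * (C2 * \<Delta>)" using V[OF i] by (intro mult_left_mono) auto
    also have "\<dots> \<le> 1 * (C2 * \<Delta>)"
      using V[OF i] C2_pos \<open>0 < \<Delta>\<close> by (intro mult_right_mono) auto
    finally show ?thesis by simp
  qed
  have "C1 * E = (\<Sum>i\<in>U. \<Sum>j\<in>N i. C1 * (V i - V j)\<^sup>2)"
    by (simp add: E_def sum_distrib_left)
  also have "\<dots> \<le> (\<Sum>i\<in>U. \<Sum>j\<in>N i. c i j * (V i - V j)\<^sup>2)"
    using c_ge by (intro sum_mono mult_right_mono) auto
  also have "\<dots> = 2 * (\<Sum>i\<in>U. V i * current V i)" by (rule energy_eq)
  also have "(\<Sum>i\<in>U. V i * current V i) = (\<Sum>x\<in>\<Gamma>. V x * current V x)"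
    using \<Gamma> finite_vertices harm by (intro sum.mono_neutral_right) auto
  also have "\<dots> \<le> (\<Sum>x\<in>\<Gamma>. C2 * \<Delta>)" using \<Gamma> current_le by (intro sum_mono) auto
  finally have "C1 * E \<le> 2 * card \<Gamma> * C2 * \<Delta>" by simp
  then have E: "E \<le> 2 * card \<Gamma> * C2 * \<Delta> / C1"
    using C1_pos by (simp add: field_simps)
  have "(\<Sum>i\<in>U. (V i - m)\<^sup>2) \<le> \<Delta> / h\<^sup>2 * (\<Sum>i\<in>U. \<Sum>j\<in>N i. ((V i - m) - (V j - m))\<^sup>2)"
    using pos neg deg \<open>0 < \<Delta>\<close> by (intro poincare_median) auto
  also have "\<dots> = \<Delta> / h\<^sup>2 * E" by (simp add: E_def)
  also have "\<dots> \<le> \<Delta> / h\<^sup>2 * (2 * card \<Gamma> * C2 * \<Delta> / C1)"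
    using E \<open>0 < \<Delta>\<close> by (intro mult_left_mono) auto
  also have "\<dots> = 2 * card \<Gamma> * C2 / C1 * (\<Delta> / h)\<^sup>2"
    by (simp add: power2_eq_square mult_ac)
  finally show ?thesis .
qed

theorem harmonic_near_boundary_mean:
  fixes \<Delta> :: real
  assumes \<Gamma>: "\<Gamma> \<subseteq> U" "\<Gamma> \<noteq> {}" and harm: "\<And>i. i \<in> U - \<Gamma> \<Longrightarrow> current V i = 0"
    and bd: "\<And>x. x \<in> \<Gamma> \<Longrightarrow> 0 \<le> V x \<and> V x \<le> 1"
    and deg: "\<And>i. i \<in> U \<Longrightarrow> card (N i) \<le> \<Delta>"
    and codeg: "\<And>i k. i \<in> U \<Longrightarrow> k \<in> U \<Longrightarrow> i \<noteq> k \<Longrightarrow> card (N i \<inter> N k) \<le> 2"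
    and i: "i \<in> U - \<Gamma>"
  shows "\<bar>V i - (\<Sum>x\<in>\<Gamma>. V x * cond x) / (\<Sum>x\<in>\<Gamma>. cond x)\<bar>
    \<le> (3 * card \<Gamma> + 2 * sqrt (6 * card \<Gamma> * C2 / C1 * (\<Delta> / h)\<^sup>2)) * (C2 / (C1 * h))"
proof -
  have \<Delta>: "0 < \<Delta>" using deg[of i] min_degree[OF _ card_U, of i] i h_pos by simp
  have V: "0 \<le> V j \<and> V j \<le> 1" if "j \<in> U" for j
  proof -
    have "V j \<le> 1" using bd by (rule maximum_principle[OF \<Gamma> conjunct2 harm that])
    \<comment> \<open>The lower bound for \<open>V\<close> is the maximum principle applied to
      \<open>- V\<close>.\<close>
    moreover have "current (\<lambda>j. - V j) k = - current V k" for k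
      unfolding current_def sum_negf[symmetric] by (intro sum.cong) (auto simp: algebra_simps)
    then have "- V j \<le> 0"
      using bd harm by (intro maximum_principle[OF \<Gamma> _ _ that, of "\<lambda>j. - V j"]) auto
    ultimately show ?thesis by simp
  qed
  obtain m where m: "m \<in> V ` U" and pos: "2 * card {i \<in> U. m < V i} \<le> card U"
    and neg: "2 * card {i \<in> U. V i < m} \<le> card U"
    using median_exists[of U V] finite_vertices i by blast
  have bounded: "\<bar>V j - m\<bar> \<le> 1" if "j \<in> U" for j
  proof -
    obtain k where "k \<in> U" "m = V k" using m by blast
    then show ?thesis using V[OF that] V[of k] by (simp add: abs_le_iff)
  qed
  define B where "B = (card \<Gamma> + sqrt (3 * (2 * card \<Gamma> * C2 / C1 * (\<Delta> / h)\<^sup>2))) * (C2 / (C1 * h))"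
  have B: "\<bar>V j - m\<bar> \<le> B" if "j \<in> U - \<Gamma>" for j
    unfolding B_def
  proof (rule harmonic_pointwise[OF \<Gamma>(1) harm _ _ codeg that])
    show "\<bar>V x - m\<bar> \<le> 1" if "x \<in> \<Gamma>" for x using that \<Gamma>(1) bounded by blast
    show "(\<Sum>i\<in>U. (V i - m)\<^sup>2) \<le> 2 * card \<Gamma> * C2 / C1 * (\<Delta> / h)\<^sup>2"
      by (rule harmonic_l2[OF \<Gamma>(1) harm V deg \<Delta> pos neg])
  qed
  then have "0 \<le> B" using i by fastforce
  then have "\<bar>(\<Sum>x\<in>\<Gamma>. V x * cond x) / (\<Sum>x\<in>\<Gamma>. cond x) - m\<bar> \<le> B + card \<Gamma> * (C2 / (C1 * h))"
    using \<Gamma> harm bounded B by (intro boundary_mean_near_constant) blast+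
  \<comment> \<open>Triangle inequality through \<open>m\<close>: one \<open>B\<close> on each side,
    which yields the constants 3 and 6 in the final bound.\<close>
  then have "\<bar>V i - (\<Sum>x\<in>\<Gamma>. V x * cond x) / (\<Sum>x\<in>\<Gamma>. cond x)\<bar> \<le> 2 * B + card \<Gamma> * (C2 / (C1 * h))"
    using B[OF i] by linarith
  also have "\<dots> = (3 * card \<Gamma> + 2 * sqrt (6 * card \<Gamma> * C2 / C1 * (\<Delta> / h)\<^sup>2)) * (C2 / (C1 * h))"
    by (simp add: B_def algebra_simps)
  finally show ?thesis .
qed

end

section \<open>Tail bounds in the random graph\<close>

lemma prob_bex_le:
  assumes "finite X"
  shows "measure_pmf.prob M {f. \<exists>x\<in>X. P x f} \<le> (\<Sum>x\<in>X. measure_pmf.prob M {f. P x f})"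
proof -
  have "{f. \<exists>x\<in>X. P x f} = (\<Union>x\<in>X. {f. P x f})" by auto
  then show ?thesis
    using measure_pmf.finite_measure_subadditive_finite[of X "\<lambda>x. {f. P x f}" M] assms by auto
qed

text \<open>Exponential Markov inequality. Keeping the factor \<open>t\<close> on both sides of the
  event lets one statement serve both tails: \<open>t = 1\<close> for large degrees and negative
  \<open>t\<close> for small cuts.\<close>

lemma chernoff_Pi_bernoulli:
  fixes p t a :: real
  assumes A: "finite A" and F: "F \<subseteq> A" and p: "0 \<le> p" "p \<le> 1"
  shows "measure_pmf.prob (Pi_pmf A False (\<lambda>_. bernoulli_pmf p)) {f. t * a \<le> t * card {e \<in> F. f e}}
    \<le> exp (card F * p * (exp t - 1) - t * a)"
proof -
  let ?M = "Pi_pmf A False (\<lambda>_. bernoulli_pmf p)"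
  \<comment> \<open>Edges outside \<open>F\<close> get weight 1, so the product over all of
    \<open>A\<close> is the exponential of the count and its expectation factorises by
    independence.\<close>
  define w where "w e b = (if e \<in> F \<and> b then exp t else 1)" for e b
  define X where "X f = (\<Prod>e\<in>A. w e (f e))" for f
  have X: "X f = exp (t * card {e \<in> F. f e})" for f
  proof -
    have "X f = (\<Prod>e\<in>{e \<in> F. f e}. exp t)"
      unfolding X_def using F A by (intro prod.mono_neutral_cong_right) (auto simp: w_def)
    then show ?thesis by (simp add: exp_of_nat2_mult)
  qed
  have int: "integrable (measure_pmf (bernoulli_pmf p)) (w e)" for e
    by (intro integrable_measure_pmf_finite) auto
  have "measure_pmf.expectation ?M X = (\<Prod>e\<in>A. measure_pmf.expectation (bernoulli_pmf p) (w e))"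
    unfolding X_def by (intro expectation_prod_Pi_pmf A int) (auto simp: w_def)
  also have "\<dots> = (\<Prod>e\<in>F. 1 + p * (exp t - 1))"
    using p A F by (intro prod.mono_neutral_cong_right) (auto simp: w_def algebra_simps)
  also have "\<dots> = (1 + p * (exp t - 1)) ^ card F" by simp
  also have "\<dots> \<le> exp (p * (exp t - 1)) ^ card F"
  proof (rule power_mono)
    show "1 + p * (exp t - 1) \<le> exp (p * (exp t - 1))" by (rule exp_ge_add_one_self)
    have "0 \<le> (1 - p) + p * exp t" using p by simp
    then show "0 \<le> 1 + p * (exp t - 1)" by (simp add: algebra_simps)
  qed
  also have "\<dots> = exp (card F * p * (exp t - 1))"
    by (simp add: exp_of_nat_mult mult.assoc)
  finally have E: "measure_pmf.expectation ?M X \<le> exp (card F * p * (exp t - 1))" .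
  have "measure_pmf.prob ?M {f. t * a \<le> t * card {e \<in> F. f e}}
      = measure_pmf.prob ?M {f \<in> space (measure_pmf ?M). exp (t * a) \<le> X f}"
    by (simp add: X)
  also have "\<dots> \<le> measure_pmf.expectation ?M X / exp (t * a)"
  proof (rule integral_Markov_inequality_measure)
    show "integrable (measure_pmf ?M) X"
      unfolding X_def using A int by (intro integrable_prod_Pi_pmf) auto
  qed (auto simp: X)
  also have "\<dots> \<le> exp (card F * p * (exp t - 1)) / exp (t * a)"
    using E by (intro divide_right_mono) auto
  finally show ?thesis by (simp add: exp_diff)
qed

lemma prob_all_Pi_bernoulli:
  fixes p :: real
  assumes A: "finite A" and F: "F \<subseteq> A" and p: "0 \<le> p" "p \<le> 1"
  shows "measure_pmf.prob (Pi_pmf A False (\<lambda>_. bernoulli_pmf p)) {f. \<forall>e\<in>F. f e} = p ^ card F"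
proof -
  define B where "B e = (if e \<in> F then {True} else UNIV)" for e
  have "{f. \<forall>e\<in>F. f e} = Pi A B" using F by (auto simp: B_def Pi_def)
  then have "measure_pmf.prob (Pi_pmf A False (\<lambda>_. bernoulli_pmf p)) {f. \<forall>e\<in>F. f e}
      = (\<Prod>e\<in>A. measure_pmf.prob (bernoulli_pmf p) (B e))"
    using measure_Pi_pmf_Pi[OF A, of False "\<lambda>_. bernoulli_pmf p" B] by simp
  also have "\<dots> = (\<Prod>e\<in>F. p)"
    using p A F by (intro prod.mono_neutral_cong_right) (auto simp: B_def measure_pmf_single)
  finally show ?thesis by simp
qed

section \<open>Edge boundaries of vertex sets in the random graph\<close>

definition edges_between :: "nat set \<Rightarrow> nat set \<Rightarrow> (nat \<times> nat) set" where
  "edges_between S T = (\<lambda>(i, j). (min i j, max i j)) ` (S \<times> T)"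

text \<open>Sorting a pair forgets its orientation; disjointness of \<open>S\<close> and
  \<open>T\<close> recovers it, since it tells which end lies in \<open>S\<close>.\<close>

lemma inj_on_min_max:
  assumes "S \<inter> T = {}"
  shows "inj_on (\<lambda>(i, j). (min i j, max i j :: nat)) (S \<times> T)"
  using assms by (auto simp: inj_on_def min_def max_def split: if_splits)

lemma card_edges_between: "S \<inter> T = {} \<Longrightarrow> card (edges_between S T) = card S * card T"
  by (simp add: edges_between_def card_image inj_on_min_max card_cartesian_product)

lemma finite_pairs: "finite {(i, j). i < j \<and> j < (n :: nat)}"
  by (rule finite_subset[of _ "{..<n} \<times> {..<n}"]) auto

lemma edges_between_subset:
  assumes "S \<subseteq> {..<n}" "T \<subseteq> {..<n}" "S \<inter> T = {}"
  shows "edges_between S T \<subseteq> {(i, j). i < j \<and> j < n}"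
proof -
  have "min i j < max i j \<and> max i j < n" if "i \<in> S" "j \<in> T" for i j
  proof -
    have "i \<noteq> j" "i < n" "j < n" using assms that by auto
    then show ?thesis by auto
  qed
  then show ?thesis by (auto simp: edges_between_def)
qed

definition boundary_size :: "nat \<Rightarrow> (nat \<times> nat \<Rightarrow> bool) \<Rightarrow> nat set \<Rightarrow> nat" where
  "boundary_size n f S = (\<Sum>i\<in>S. card (neighbours n f i - S))"

text \<open>Expresses the boundary as the number of present edges among a set of possible edges that
  does not depend on \<open>f\<close>, which is the form the Chernoff bound takes.\<close>

lemma boundary_size_eq:
  assumes "S \<subseteq> {..<n}"
  shows "boundary_size n f S = card {e \<in> edges_between S ({..<n} - S). f e}"
proof -
  have "finite S" using assms finite_subset by blast
  then have "boundary_size n f S = card (SIGMA i:S. neighbours n f i - S)"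
    by (simp add: boundary_size_def neighbours_def)
  also have "\<dots> = card ((\<lambda>(i, j). (min i j, max i j)) ` (SIGMA i:S. neighbours n f i - S))"
    by (intro card_image[symmetric] inj_on_subset[OF inj_on_min_max[of S "- S"]]) auto
  also have "(\<lambda>(i, j). (min i j, max i j)) ` (SIGMA i:S. neighbours n f i - S)
      = {e \<in> edges_between S ({..<n} - S). f e}"
    by (force simp: edges_between_def neighbours_def adj_def)
  finally show ?thesis .
qed

lemma boundary_chernoff:
  fixes p t a :: real
  assumes "0 \<le> p" "p \<le> 1" "S \<subseteq> {..<n}"
  shows "measure_pmf.prob (gnp n p) {f. t * a \<le> t * boundary_size n f S}
    \<le> exp (card S * (real n - card S) * p * (exp t - 1) - t * a)"
proof -
  let ?F = "edges_between S ({..<n} - S)"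
  have "finite S" using assms(3) finite_subset by blast
  then have "card ({..<n} - S) = n - card S" "card S \<le> n"
    using assms(3) card_mono[of "{..<n}" S] by (auto simp: card_Diff_subset)
  then have "real (card ?F) = card S * (real n - card S)"
    by (simp add: card_edges_between)
  moreover have "?F \<subseteq> {(i, j). i < j \<and> j < n}"
    using assms(3) by (intro edges_between_subset) auto
  ultimately show ?thesis
    using chernoff_Pi_bernoulli[OF finite_pairs, of ?F n p t a] assms
    by (simp add: gnp_def boundary_size_eq[OF assms(3)])
qed

text \<open>Expansion of a product of \<open>card A\<close> factors \<open>1 + r\<close>; it
  evaluates the union bound over all vertex sets.\<close>

lemma sum_pow_card:
  fixes r :: real
  assumes "finite A"
  shows "(\<Sum>S\<in>Pow A. r ^ card S) = (1 + r) ^ card A"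
  using prod_add[OF assms, of "\<lambda>_. r" "\<lambda>_. 1"] by (simp add: add.commute)

section \<open>Expansion, maximum degree and codegrees with high probability\<close>

lemma log_density_eventually:
  fixes \<alpha> :: real
  assumes "0 < \<alpha>"
  shows "\<forall>\<^sub>F n in sequentially. 0 \<le> \<alpha> * ln (real n) / real n \<and> \<alpha> * ln (real n) / real n \<le> 1"
proof -
  have "\<forall>\<^sub>F n in sequentially. 0 \<le> \<alpha> * ln (real n) / real n"
    using eventually_ge_at_top[of 1] by eventually_elim (use assms in auto)
  moreover have "\<forall>\<^sub>F n in sequentially. \<alpha> * ln (real n) / real n \<le> 1"
    using assms by real_asymp
  ultimately show ?thesis by eventually_elim auto
qed

text \<open>The factor \<open>1 - exp (- \<mu>)\<close> lost in the Chernoff bound is chosen so close to \<open>1\<close> that the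
  exponent still beats the number of sets; linear-sized sets are handled by the trivial count
  \<open>2 ^ n\<close>.\<close>

lemma expansion_whp:
  fixes \<alpha> :: real
  assumes "1 < \<alpha>"
  obtains c0 where "0 < c0"
    "(\<lambda>n. measure_pmf.prob (gnp n (\<alpha> * ln (real n) / real n))
       {f. \<exists>S\<in>{S. S \<subseteq> {..<n} \<and> S \<noteq> {} \<and> 2 * card S \<le> n}. boundary_size n f S < c0 * ln n * card S})
      \<longlonglongrightarrow> 0"
proof -
  have \<alpha>: "0 < \<alpha>" using assms by simp
  \<comment> \<open>Any \<open>\<gamma>\<close> strictly between 1 and \<open>\<alpha>\<close>
    leaves room. Then \<open>\<mu>\<close> solves
    \<open>\<alpha> * (1 - exp (- \<mu>)) = \<gamma>\<close>, \<open>c0\<close> makes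
    \<open>\<mu> * c0 = \<epsilon>\<close>, and \<open>\<theta>\<close> is small enough that
    \<open>\<gamma> * (1 - \<theta>) = 1 + 2 * \<epsilon>\<close>.\<close>
  define \<gamma> where "\<gamma> = (1 + \<alpha>) / 2"
  define \<epsilon> where "\<epsilon> = (\<gamma> - 1) / 3"
  define \<theta> where "\<theta> = \<epsilon> / \<gamma>"
  define \<kappa> where "\<kappa> = \<theta> * (\<gamma> / 2 - \<epsilon>)"
  define \<mu> where "\<mu> = ln (2 * \<alpha> / (\<alpha> - 1))"
  define c0 where "c0 = \<epsilon> / \<mu>"
  have \<gamma>: "1 < \<gamma>" and \<epsilon>: "0 < \<epsilon>" and \<theta>: "0 < \<theta>"
    using assms by (auto simp: \<gamma>_def \<epsilon>_def \<theta>_def)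
  have \<gamma>\<epsilon>: "0 < \<gamma> / 2 - \<epsilon>" using \<gamma> by (simp add: \<epsilon>_def)
  have \<kappa>: "0 < \<kappa>" using \<theta> \<gamma>\<epsilon> by (simp add: \<kappa>_def)
  have \<mu>: "0 < \<mu>" using assms by (simp add: \<mu>_def field_simps)
  have c0: "0 < c0" using \<epsilon> \<mu> by (simp add: c0_def)
  have "exp (- \<mu>) = (\<alpha> - 1) / (2 * \<alpha>)" using assms by (simp add: \<mu>_def exp_minus)
  then have \<gamma>_eq: "\<alpha> * (exp (- \<mu>) - 1) = - \<gamma>" using assms by (simp add: \<gamma>_def field_simps)
  define bad where "bad n = (\<lambda>S f. boundary_size n f S < c0 * ln n * card S)" for n :: nat
  define P where "P n = gnp n (\<alpha> * ln (real n) / real n)" for n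
  define \<S> where "\<S> n = {S. S \<subseteq> {..<n} \<and> S \<noteq> {} \<and> 2 * card S \<le> n}" for n :: nat
  define up where "up n = (exp (exp (- \<epsilon> * ln (real n))) - 1) + exp (real n * ln 2 - \<kappa> * real n * ln (real n))" for n :: nat
  have ev: "\<forall>\<^sub>F n in sequentially. measure_pmf.prob (P n) {f. \<exists>S\<in>\<S> n. bad n S f} \<le> up n"
    using log_density_eventually[OF \<alpha>] eventually_ge_at_top[of 2]
  proof eventually_elim
    case (elim n)
    define L where "L = ln (real n)"
    define r where "r = exp (- (1 + \<epsilon>) * L)"
    define \<tau> where "\<tau> = exp (- \<kappa> * real n * L)"
    have n: "0 < real n" and L: "0 < L" using elim by (auto simp: L_def)
    have fin: "finite (\<S> n)" by (rule finite_subset[of _ "Pow {..<n}"]) (auto simp: \<S>_def)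
    \<comment> \<open>The first term covers sets of size up to \<open>\<theta> * n\<close>, the
      second all larger ones; using their sum for every set avoids splitting the union
      bound.\<close>
    have each: "measure_pmf.prob (P n) {f. bad n S f} \<le> r ^ card S + \<tau>" if S: "S \<in> \<S> n" for S
    proof -
      define s where "s = real (card S)"
      have "card S > 0" using S finite_subset[of S "{..<n}"] by (auto simp: \<S>_def card_gt_0_iff)
      then have s: "0 < s" "2 * s \<le> real n" using S by (auto simp: \<S>_def s_def)
      have "measure_pmf.prob (P n) {f. bad n S f}
          \<le> measure_pmf.prob (P n) {f. - \<mu> * (c0 * L * s) \<le> - \<mu> * real (boundary_size n f S)}"
        using \<mu> by (intro measure_pmf.finite_measure_mono) (auto simp: bad_def L_def s_def)
      also have "\<dots> \<le> exp (s * (real n - s) * (\<alpha> * L / n) * (exp (- \<mu>) - 1) - (- \<mu> * (c0 * L * s)))"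
        unfolding P_def L_def s_def using elim S by (intro boundary_chernoff) (auto simp: \<S>_def)
      also have "s * (real n - s) * (\<alpha> * L / n) * (exp (- \<mu>) - 1) - (- \<mu> * (c0 * L * s))
          = s * L * ((1 - s / n) * (\<alpha> * (exp (- \<mu>) - 1)) + \<mu> * c0)"
        using n by (simp add: field_simps)
      also have "\<dots> = s * L * (\<epsilon> - \<gamma> * (1 - s / n))"
        using \<mu> unfolding \<gamma>_eq by (simp add: c0_def)
      finally have main: "measure_pmf.prob (P n) {f. bad n S f} \<le> exp (s * L * (\<epsilon> - \<gamma> * (1 - s / n)))" .
      show ?thesis
      proof (cases "s \<le> \<theta> * n")
        case True
        then have "s / n \<le> \<theta>" using n by (simp add: field_simps)
        then have "\<gamma> * (1 - \<theta>) \<le> \<gamma> * (1 - s / n)" using \<gamma> by (intro mult_left_mono) auto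
        moreover have "\<gamma> * (1 - \<theta>) = 1 + 2 * \<epsilon>" using \<gamma> by (simp add: \<theta>_def \<epsilon>_def field_simps)
        ultimately have "s * L * (\<epsilon> - \<gamma> * (1 - s / n)) \<le> s * L * (- (1 + \<epsilon>))"
          using s L by (intro mult_left_mono) auto
        then have "exp (s * L * (\<epsilon> - \<gamma> * (1 - s / n))) \<le> exp (s * (- (1 + \<epsilon>) * L))"
          by (simp add: algebra_simps)
        also have "\<dots> = r ^ card S" by (simp add: r_def s_def exp_of_nat_mult)
        finally show ?thesis using main by (simp add: \<tau>_def) (smt (verit) exp_gt_zero)
      next
        case False
        have "s / n \<le> 1 / 2" using s n by (simp add: field_simps)
        then have "\<gamma> * (1 / 2) \<le> \<gamma> * (1 - s / n)" using \<gamma> by (intro mult_left_mono) auto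
        then have "s * L * (\<epsilon> - \<gamma> * (1 - s / n)) \<le> s * L * (- (\<gamma> / 2 - \<epsilon>))"
          using s L by (intro mult_left_mono) auto
        also have "\<dots> \<le> (\<theta> * n) * L * (- (\<gamma> / 2 - \<epsilon>))"
          using False L \<gamma>\<epsilon> by (intro mult_right_mono_neg mult_right_mono) auto
        also have "\<dots> = - \<kappa> * real n * L" by (simp add: \<kappa>_def algebra_simps)
        finally have "exp (s * L * (\<epsilon> - \<gamma> * (1 - s / n))) \<le> \<tau>" by (simp add: \<tau>_def)
        moreover have "0 \<le> r ^ card S" by (simp add: r_def)
        ultimately show ?thesis using main by linarith
      qed
    qed
    have "measure_pmf.prob (P n) {f. \<exists>S\<in>\<S> n. bad n S f}
        \<le> (\<Sum>S\<in>\<S> n. measure_pmf.prob (P n) {f. bad n S f})"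
      by (rule prob_bex_le[OF fin])
    also have "\<dots> \<le> (\<Sum>S\<in>\<S> n. r ^ card S + \<tau>)" by (intro sum_mono each)
    also have "\<dots> \<le> (\<Sum>S\<in>Pow {..<n} - {{}}. r ^ card S + \<tau>)"
      by (intro sum_mono2) (auto simp: \<S>_def r_def \<tau>_def)
    \<comment> \<open>The empty set would contribute \<open>r ^ 0 = 1\<close>; removing it is what
      lets the first sum tend to 0.\<close>
    also have "\<dots> = (\<Sum>S\<in>Pow {..<n}. r ^ card S) - 1 + (\<Sum>S\<in>Pow {..<n} - {{}}. \<tau>)"
      by (subst sum.remove[of "Pow {..<n}" "{}"]) (auto simp: sum.distrib)
    also have "\<dots> \<le> (\<Sum>S\<in>Pow {..<n}. r ^ card S) - 1 + (\<Sum>S\<in>Pow {..<n}. \<tau>)"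
      by (intro add_left_mono sum_mono2) (auto simp: \<tau>_def)
    also have "\<dots> = (1 + r) ^ n - 1 + 2 ^ n * \<tau>"
      by (simp add: sum_pow_card card_Pow)
    also have "\<dots> \<le> exp (exp (- \<epsilon> * L)) - 1 + 2 ^ n * \<tau>"
    proof -
      have "(1 + r) ^ n \<le> exp r ^ n"
        by (intro power_mono exp_ge_add_one_self) (simp add: r_def)
      also have "\<dots> = exp (n * r)" by (simp add: exp_of_nat_mult)
      \<comment> \<open>The margin \<open>\<epsilon>\<close> in the exponent
        \<open>1 + \<epsilon>\<close> survives the factor \<open>n\<close>, so this tends to
        0.\<close>
      also have "real n * r = exp (- \<epsilon> * L)"
      proof -
        have "real n * r = exp L * r" using n by (simp add: L_def)
        also have "\<dots> = exp (- \<epsilon> * L)" by (simp add: r_def exp_add[symmetric] algebra_simps)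
        finally show ?thesis .
      qed
      finally show ?thesis by simp
    qed
    also have "2 ^ n * \<tau> = exp (real n * ln 2 - \<kappa> * real n * L)"
    proof -
      have "exp (real n * ln 2) = (2::real) ^ n" by (simp add: exp_of_nat_mult)
      then show ?thesis by (simp add: \<tau>_def exp_diff exp_minus field_simps)
    qed
    finally show ?case by (simp add: up_def L_def)
  qed
  have "up \<longlonglongrightarrow> 0"
    unfolding up_def using \<epsilon> \<kappa> by real_asymp
  then have "(\<lambda>n. measure_pmf.prob (P n) {f. \<exists>S\<in>\<S> n. bad n S f}) \<longlonglongrightarrow> 0"
    by (intro tendsto_sandwich[OF _ ev tendsto_const]) auto
  then show ?thesis
    unfolding P_def \<S>_def bad_def by (rule that[OF c0])
qed

lemma max_degree_whp:
  fixes \<alpha> :: real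
  assumes "0 < \<alpha>"
  obtains D where
    "(\<lambda>n. measure_pmf.prob (gnp n (\<alpha> * ln (real n) / real n))
       {f. \<exists>i\<in>{..<n}. D * ln n < card (neighbours n f i)}) \<longlonglongrightarrow> 0"
proof -
  \<comment> \<open>With \<open>t = 1\<close> the Chernoff exponent becomes at most
    \<open>- 2 * L\<close>, so each vertex fails with probability at most n^-2 and the union bound
    gives 1 / n.\<close>
  define D where "D = \<alpha> * (exp 1 - 1) + 2"
  define P where "P n = gnp n (\<alpha> * ln (real n) / real n)" for n
  have ev: "\<forall>\<^sub>F n in sequentially.
      measure_pmf.prob (P n) {f. \<exists>i\<in>{..<n}. D * ln n < card (neighbours n f i)} \<le> 1 / real n"
    using log_density_eventually[OF assms] eventually_ge_at_top[of 2]
  proof eventually_elim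
    case (elim n)
    define L where "L = ln (real n)"
    have n: "0 < real n" and L: "0 < L" using elim by (auto simp: L_def)
    have each: "measure_pmf.prob (P n) {f. D * ln n < card (neighbours n f i)} \<le> exp (- 2 * L)"
      if i: "i \<in> {..<n}" for i
    proof -
      have nb: "neighbours n f i - {i} = neighbours n f i" for f by (auto simp: neighbours_def adj_def)
      have "measure_pmf.prob (P n) {f. D * ln n < card (neighbours n f i)}
          \<le> measure_pmf.prob (P n) {f. 1 * (D * L) \<le> 1 * real (boundary_size n f {i})}"
        by (intro measure_pmf.finite_measure_mono) (auto simp: boundary_size_def nb L_def)
      also have "\<dots> \<le> exp (card {i} * (real n - card {i}) * (\<alpha> * L / n) * (exp 1 - 1) - 1 * (D * L))"
        unfolding P_def L_def using elim i by (intro boundary_chernoff) auto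
      also have "\<dots> \<le> exp (real n * (\<alpha> * L / n) * (exp 1 - 1) - D * L)"
      proof -
        have "real (card {i}) * (real n - card {i}) * (\<alpha> * L / n) * (exp 1 - 1)
            \<le> real n * (\<alpha> * L / n) * (exp 1 - 1)"
          using assms L n by (intro mult_right_mono) auto
        then show ?thesis by simp
      qed
      also have "real n * (\<alpha> * L / n) * (exp 1 - 1) - D * L = - 2 * L"
        using n by (simp add: D_def algebra_simps)
      finally show ?thesis .
    qed
    have "measure_pmf.prob (P n) {f. \<exists>i\<in>{..<n}. D * ln n < card (neighbours n f i)}
        \<le> (\<Sum>i<n. measure_pmf.prob (P n) {f. D * ln n < card (neighbours n f i)})"
      by (rule prob_bex_le) simp
    also have "\<dots> \<le> (\<Sum>i<n. exp (- 2 * L))" by (intro sum_mono each)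
    also have "\<dots> = 1 / real n"
    proof -
      have "exp (- 2 * L) = 1 / (exp L * exp L)"
        by (simp add: exp_minus exp_add[symmetric] field_simps)
      then show ?thesis using n by (simp add: L_def)
    qed
    finally show ?case .
  qed
  have "(\<lambda>n. 1 / real n) \<longlonglongrightarrow> 0" by real_asymp
  then have "(\<lambda>n. measure_pmf.prob (P n) {f. \<exists>i\<in>{..<n}. D * ln n < card (neighbours n f i)}) \<longlonglongrightarrow> 0"
    by (intro tendsto_sandwich[OF _ ev tendsto_const]) auto
  then show ?thesis unfolding P_def by (rule that)
qed

lemma binomial_le_power: "n choose k \<le> n ^ k"
proof (cases "k \<le> n")
  case True
  then show ?thesis by (rule binomial_le_pow)
qed (simp add: binomial_eq_0)

text \<open>Three common neighbours of two vertices give a complete bipartite graph with sides 2 and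
  3. There are at most n^5 places for it, each occupied with probability p^6, and n^5 p^6 tends to
  0. For two common neighbours the corresponding n^4 p^4 does not, whence the bound 2.\<close>

lemma codegree_whp:
  fixes \<alpha> :: real
  assumes "0 < \<alpha>"
  shows "(\<lambda>n. measure_pmf.prob (gnp n (\<alpha> * ln (real n) / real n))
       {f. \<exists>i<n. \<exists>k<n. i \<noteq> k \<and> 2 < card (neighbours n f i \<inter> neighbours n f k)}) \<longlonglongrightarrow> 0"
proof -
  define P where "P n = gnp n (\<alpha> * ln (real n) / real n)" for n
  define B where "B n = {f. \<exists>i<n. \<exists>k<n. i \<noteq> k \<and> 2 < card (neighbours n f i \<inter> neighbours n f k)}" for n
  define X where "X n = {(S, T). S \<subseteq> {..<n} \<and> card S = 2 \<and> T \<subseteq> {..<n} \<and> card T = 3 \<and> S \<inter> T = {}}" for n :: nat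
  have ev: "\<forall>\<^sub>F n in sequentially. measure_pmf.prob (P n) (B n) \<le> real n ^ 5 * (\<alpha> * ln (real n) / real n) ^ 6"
    using log_density_eventually[OF assms]
  proof eventually_elim
    case (elim n)
    define p where "p = \<alpha> * ln (real n) / real n"
    have Xsub: "X n \<subseteq> {S. S \<subseteq> {..<n} \<and> card S = 2} \<times> {T. T \<subseteq> {..<n} \<and> card T = 3}"
      by (auto simp: X_def)
    have fin: "finite (X n)" by (rule finite_subset[OF Xsub]) auto
    have "card (X n) \<le> (n choose 2) * (n choose 3)"
      using card_mono[OF _ Xsub] by (simp add: card_cartesian_product n_subsets)
    also have "\<dots> \<le> n ^ 2 * n ^ 3" by (intro mult_le_mono binomial_le_power)
    finally have cardX: "card (X n) \<le> n ^ 5" by (simp flip: power_add)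
    have "B n \<subseteq> {f. \<exists>x\<in>X n. \<forall>e\<in>edges_between (fst x) (snd x). f e}"
    proof
      fix f assume "f \<in> B n"
      then obtain i k where ik: "i < n" "k < n" "i \<noteq> k" "3 \<le> card (neighbours n f i \<inter> neighbours n f k)"
        by (auto simp: B_def)
      then obtain T where T: "T \<subseteq> neighbours n f i \<inter> neighbours n f k" "card T = 3"
        by (metis obtain_subset_with_card_n)
      have "({i, k}, T) \<in> X n"
        using ik T by (auto simp: X_def neighbours_def adj_def)
      moreover have "\<forall>e\<in>edges_between {i, k} T. f e"
        using T by (auto simp: edges_between_def neighbours_def adj_def)
      ultimately show "f \<in> {f. \<exists>x\<in>X n. \<forall>e\<in>edges_between (fst x) (snd x). f e}" by force
    qed
    then have "measure_pmf.prob (P n) (B n)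
        \<le> measure_pmf.prob (P n) {f. \<exists>x\<in>X n. \<forall>e\<in>edges_between (fst x) (snd x). f e}"
      by (intro measure_pmf.finite_measure_mono) auto
    also have "\<dots> \<le> (\<Sum>x\<in>X n. measure_pmf.prob (P n) {f. \<forall>e\<in>edges_between (fst x) (snd x). f e})"
      by (rule prob_bex_le[OF fin])
    also have "\<dots> = (\<Sum>x\<in>X n. p ^ 6)"
    proof (intro sum.cong refl)
      fix x assume x: "x \<in> X n"
      then have sub: "edges_between (fst x) (snd x) \<subseteq> {(i, j). i < j \<and> j < n}"
        by (intro edges_between_subset) (auto simp: X_def)
      have "card (edges_between (fst x) (snd x)) = 6"
        using x by (subst card_edges_between) (auto simp: X_def)
      then show "measure_pmf.prob (P n) {f. \<forall>e\<in>edges_between (fst x) (snd x). f e} = p ^ 6"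
        using prob_all_Pi_bernoulli[OF finite_pairs sub, of p] elim by (simp add: P_def gnp_def p_def)
    qed
    also have "\<dots> = real (card (X n)) * p ^ 6" by simp
    also have "\<dots> \<le> real (n ^ 5) * p ^ 6"
      using cardX by (intro mult_right_mono of_nat_mono) auto
    finally show ?case by (simp add: p_def)
  qed
  have "(\<lambda>n. real n ^ 5 * (\<alpha> * ln (real n) / real n) ^ 6) \<longlonglongrightarrow> 0"
    using assms by real_asymp
  then have "(\<lambda>n. measure_pmf.prob (P n) (B n)) \<longlonglongrightarrow> 0"
    by (intro tendsto_sandwich[OF _ ev tendsto_const]) auto
  then show ?thesis unfolding P_def B_def .
qed

section \<open>Potentials on the random graph\<close>

lemma finite_graph_neighbours: "finite_graph {..<n} (neighbours n f)"
  by unfold_locales (auto simp: neighbours_def adj_def min.commute max.commute)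

lemma expander_neighbours:
  fixes h :: real
  assumes "0 < h"
    and ex: "\<And>S. S \<subseteq> {..<n} \<Longrightarrow> S \<noteq> {} \<Longrightarrow> 2 * card S \<le> n \<Longrightarrow> h * card S \<le> boundary_size n f S"
  shows "expander {..<n} (neighbours n f) h"
proof -
  interpret finite_graph "{..<n}" "neighbours n f" by (rule finite_graph_neighbours)
  show ?thesis
  proof
    fix S assume "S \<subseteq> {..<n}" "2 * card S \<le> card {..<n}"
    then show "h * card S \<le> cut S"
      using ex[of S] by (cases "S = {}") (auto simp: cut_def boundary_size_def)
  qed (rule assms)
qed

text \<open>The set of vertices reachable from \<open>i\<close> is closed under taking neighbours,
  so expansion makes it everything.\<close>

lemma expander_connected:
  assumes "expander {..<n} (neighbours n f) h"
  shows "graph_connected n f"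
  unfolding graph_connected_def
proof (intro allI impI)
  interpret expander "{..<n}" "neighbours n f" h by (rule assms)
  fix i j assume "i < n" "j < n"
  define A where "A = {k. k < n \<and> (adj f)\<^sup>*\<^sup>* i k}"
  have "A = {..<n}"
  proof (rule closed_set_is_everything)
    show "A \<noteq> {}" using \<open>i < n\<close> by (auto simp: A_def)
    show "neighbours n f k \<subseteq> A" if "k \<in> A" for k
      using that by (auto simp: A_def neighbours_def intro: rtranclp.rtrancl_into_rtrancl)
  qed (auto simp: A_def)
  then show "(adj f)\<^sup>*\<^sup>* i j" using \<open>j < n\<close> by (auto simp: A_def)
qed

text \<open>The network estimate is used with \<open>h = c0 * ln n\<close> and
  \<open>\<Delta> = D * ln n\<close>. The logarithms cancel in \<open>\<Delta> / h\<close>, and the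
  remaining factor \<open>C2 / (C1 * h)\<close> supplies the rate.\<close>

lemma good_event_of_expander:
  fixes c0 D C1 C2 :: real
  assumes pos: "0 < c0" "0 < C1" "1 \<le> K" and n: "2 \<le> n"
    and ex: "\<And>S. S \<subseteq> {..<n} \<Longrightarrow> S \<noteq> {} \<Longrightarrow> 2 * card S \<le> n \<Longrightarrow>
      c0 * ln n * card S \<le> boundary_size n f S"
    and deg: "\<And>i. i < n \<Longrightarrow> card (neighbours n f i) \<le> D * ln n"
    and codeg: "\<And>i k. i < n \<Longrightarrow> k < n \<Longrightarrow> i \<noteq> k \<Longrightarrow> card (neighbours n f i \<inter> neighbours n f k) \<le> 2"
  shows "good_event n C1 C2 K ((3 * real K + 2 * sqrt (6 * real K * C2 / C1 * (D / c0)\<^sup>2)) * (C2 / (C1 * c0))) f"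
  unfolding good_event_def
proof (intro conjI allI impI)
  have L: "0 < ln (real n)" using n by simp
  have exp: "expander {..<n} (neighbours n f) (c0 * ln n)"
    using pos L by (intro expander_neighbours ex) auto
  then show "graph_connected n f" by (rule expander_connected)
  fix c x pv V i
  assume adm: "admissible_cond n f C1 C2 c" and inj: "inj_on x {..<K}" and xn: "x ` {..<K} \<subseteq> {..<n}"
    and pv: "\<forall>k<K. 0 \<le> pv k \<and> pv k \<le> 1" and V: "is_potential n f c K x pv V"
    and i: "i < n" "i \<notin> x ` {..<K}"
  interpret expander "{..<n}" "neighbours n f" "c0 * ln n" by (rule exp)
  interpret network "{..<n}" "neighbours n f" "c0 * ln n" c C1 C2
    using adm pos n by unfold_locales (auto simp: admissible_cond_def neighbours_def)
  have tc: "total_cond n f c = cond" by (auto simp: total_cond_def cond_def)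
  have sums: "(\<Sum>k<K. pv k * total_cond n f c (x k)) = (\<Sum>y\<in>x ` {..<K}. V y * cond y)"
    "(\<Sum>k<K. total_cond n f c (x k)) = (\<Sum>y\<in>x ` {..<K}. cond y)"
    using V by (simp_all add: sum.reindex[OF inj] tc is_potential_def)
  have card\<Gamma>: "card (x ` {..<K}) = K" using card_image[OF inj] by simp
  have "\<bar>V i - (\<Sum>y\<in>x ` {..<K}. V y * cond y) / (\<Sum>y\<in>x ` {..<K}. cond y)\<bar>
    \<le> (3 * card (x ` {..<K}) + 2 * sqrt (6 * card (x ` {..<K}) * C2 / C1 * ((D * ln n) / (c0 * ln n))\<^sup>2))
      * (C2 / (C1 * (c0 * ln n)))"
  proof (rule harmonic_near_boundary_mean[OF xn])
    show "x ` {..<K} \<noteq> {}" using pos by (auto simp: lessThan_empty_iff)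
    show "current V j = 0" if "j \<in> {..<n} - x ` {..<K}" for j
      using V that by (auto simp: is_potential_def current_def)
    show "0 \<le> V y \<and> V y \<le> 1" if "y \<in> x ` {..<K}" for y
      using V pv that by (auto simp: is_potential_def)
  qed (use deg codeg i in auto)
  also have "\<dots> = (3 * real K + 2 * sqrt (6 * real K * C2 / C1 * (D / c0)\<^sup>2)) * (C2 / (C1 * c0)) / ln (real n)"
    using L by (simp add: card\<Gamma>)
  finally show "\<bar>V i - (\<Sum>k<K. pv k * total_cond n f c (x k)) / (\<Sum>k<K. total_cond n f c (x k))\<bar>
    \<le> (3 * real K + 2 * sqrt (6 * real K * C2 / C1 * (D / c0)\<^sup>2)) * (C2 / (C1 * c0)) / ln (real n)"
    unfolding sums .
qed

theorem theorem1p1: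
  fixes \<alpha> C1 C2 :: real and K :: nat
  assumes "\<alpha> > 1" and "0 < C1" and "C1 \<le> C2" and "K \<ge> 1"
  shows "\<exists>M. (\<lambda>n. measure_pmf.prob (gnp n (\<alpha> * ln (real n) / real n))
                  {f. good_event n C1 C2 K M f}) \<longlonglongrightarrow> 1"
proof -
  define P where "P n = gnp n (\<alpha> * ln (real n) / real n)" for n
  have \<alpha>: "0 < \<alpha>" using assms by simp
  obtain c0 where c0: "0 < c0" and ex:
    "(\<lambda>n. measure_pmf.prob (P n)
       {f. \<exists>S\<in>{S. S \<subseteq> {..<n} \<and> S \<noteq> {} \<and> 2 * card S \<le> n}. boundary_size n f S < c0 * ln n * card S})
      \<longlonglongrightarrow> 0"
    using expansion_whp[OF assms(1)] unfolding P_def by blast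
  obtain D where deg:
    "(\<lambda>n. measure_pmf.prob (P n) {f. \<exists>i\<in>{..<n}. D * ln n < card (neighbours n f i)}) \<longlonglongrightarrow> 0"
    using max_degree_whp[OF \<alpha>] unfolding P_def by blast
  have codeg: "(\<lambda>n. measure_pmf.prob (P n)
       {f. \<exists>i<n. \<exists>k<n. i \<noteq> k \<and> 2 < card (neighbours n f i \<inter> neighbours n f k)}) \<longlonglongrightarrow> 0"
    using codegree_whp[OF \<alpha>] unfolding P_def .
  \<comment> \<open>Since \<open>c0\<close> and \<open>D\<close> come from \<open>\<alpha>\<close>
    alone, \<open>M\<close> depends only on \<open>\<alpha>\<close>, \<open>C1\<close>,
    \<open>C2\<close> and \<open>K\<close>.\<close>
  define M where "M = (3 * real K + 2 * sqrt (6 * real K * C2 / C1 * (D / c0)\<^sup>2)) * (C2 / (C1 * c0))"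
  define B1 B2 B3 where
    "B1 n = {f. \<exists>S\<in>{S. S \<subseteq> {..<n} \<and> S \<noteq> {} \<and> 2 * card S \<le> n}. boundary_size n f S < c0 * ln n * card S}"
    and "B2 n = {f. \<exists>i\<in>{..<n}. D * ln n < card (neighbours n f i)}"
    and "B3 n = {f. \<exists>i<n. \<exists>k<n. i \<noteq> k \<and> 2 < card (neighbours n f i \<inter> neighbours n f k)}" for n
  define low where "low n = 1 - (measure_pmf.prob (P n) (B1 n) + measure_pmf.prob (P n) (B2 n)
    + measure_pmf.prob (P n) (B3 n))" for n
  have lower: "\<forall>\<^sub>F n in sequentially. low n \<le> measure_pmf.prob (P n) {f. good_event n C1 C2 K M f}"
    using eventually_ge_at_top[of 2]
  proof eventually_elim
    case (elim n)
    let ?G = "{f. good_event n C1 C2 K M f}"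
    \<comment> \<open>Outside the three bad events the deterministic estimate holds for every
      network and all boundary data, so no union over conductances arises.\<close>
    have "- ?G \<subseteq> B1 n \<union> B2 n \<union> B3 n"
    proof
      fix f assume "f \<in> - ?G"
      then have bad: "\<not> good_event n C1 C2 K M f" by simp
      show "f \<in> B1 n \<union> B2 n \<union> B3 n"
      proof (rule ccontr)
        assume "f \<notin> B1 n \<union> B2 n \<union> B3 n"
        then have "f \<notin> B1 n" "f \<notin> B2 n" "f \<notin> B3 n" by auto
        then have "good_event n C1 C2 K M f"
          unfolding M_def B1_def B2_def B3_def
          by (intro good_event_of_expander[OF c0 assms(2,4) elim]) (force simp: not_less)+
        with bad show False by simp
      qed
    qed
    then have "measure_pmf.prob (P n) (- ?G) \<le> measure_pmf.prob (P n) (B1 n \<union> B2 n \<union> B3 n)"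
      by (intro measure_pmf.finite_measure_mono) auto
    also have "\<dots> \<le> measure_pmf.prob (P n) (B1 n \<union> B2 n) + measure_pmf.prob (P n) (B3 n)"
      by (intro measure_Un_le) auto
    also have "\<dots> \<le> measure_pmf.prob (P n) (B1 n) + measure_pmf.prob (P n) (B2 n) + measure_pmf.prob (P n) (B3 n)"
      by (intro add_right_mono measure_Un_le) auto
    finally show ?case
      using measure_pmf.prob_compl[of ?G "P n"] by (simp add: low_def Compl_eq_Diff_UNIV)
  qed
  have "low \<longlonglongrightarrow> 1 - (0 + 0 + 0)"
    unfolding low_def B1_def B2_def B3_def by (intro tendsto_intros ex deg codeg)
  then have "low \<longlonglongrightarrow> 1" by simp
  then have "(\<lambda>n. measure_pmf.prob (P n) {f. good_event n C1 C2 K M f}) \<longlonglongrightarrow> 1"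
    by (intro tendsto_sandwich[OF lower _ _ tendsto_const]) auto
  then show ?thesis unfolding P_def by blast
qed

end
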